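(* For every positive integer $d$ and real number $\alpha \in (0,1]$, there exists a real number $\beta = \beta(\alpha, d) > 0$ such that the following holds. Assume that $\mathcal{F}$ is a finite family of convex sets in $\mathbb{R}^d$ and let $k$ be a positive integer. If $\bigcap \mathcal H$ contains at least $k$ colinear integer points for at least $\alpha \binom{|\mathcal{F}|}{2d+1}$ subcollections $\mathcal H \subseteq \mathcal F$ of $2d+1$ sets, then there exists a subfamily $\mathcal G \subseteq \mathcal{F}$ such that $|\mathcal G| \ge \beta |\mathcal{F}|$ whose intersection contains $k$ colinear integer points.
   Context: An integer point is a point of $\mathbb{Z}^d$. A set contains $k$ colinear integer points if it contains $k$ distinct points of $\mathbb{Z}^d$ lying on a common line. For a family $\mathcal H$ of sets, $\bigcap \mathcal H$ denotes the intersection of all its members. The constant $\beta$ depends only on $\alpha$ and $d$ (not on $k$ or $\mathcal{F}$).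
   Formalization: The formal statement additionally assumes that the family F has at least 2d+1 members; otherwise the binomial coefficient is 0, the hypothesis is vacuous and the claim fails, e.g. for the family consisting of the empty set alone. *)

theory Defs
  imports "HOL-Analysis.Analysis"
begin

definition integer_points :: "(real ^ 'n) set" where
  "integer_points = {x. \<forall>i. x $ i \<in> \<int>}"

text \<open>The library's \<^const>\<open>collinear\<close> also accepts the empty set and singletons; these lie on a line too,
  since the dimension \<open>CARD('n)\<close> is at least one.\<close>

definition contains_colinear_integer_points :: "nat \<Rightarrow> (real ^ 'n) set \<Rightarrow> bool" where
  "contains_colinear_integer_points k S \<longleftrightarrow>
     (\<exists>P. P \<subseteq> S \<inter> integer_points \<and> finite P \<and> card P = k \<and> collinear P)"

end

theory Submission
  imports Defs "HOL-Library.Ramsey"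
begin

text \<open>
  A convex set contains \<open>k\<close> colinear integer points if and only if it contains
  \<open>x\<close> and \<open>x + (k - 1) v\<close> for integer vectors \<open>x\<close> and \<open>v \<noteq> 0\<close>: any two integer points
  of a line differ by an integer multiple of one vector, so the hull of any \<open>k\<close> of them contains \<open>k\<close> consecutive ones.
  Hence every convex \<open>C\<close> in dimension \<open>d\<close> may be replaced by the convex set of pairs
  \<open>(x, v)\<close> with \<open>x\<close> and \<open>x + (k - 1) v\<close> in \<open>C\<close>, in dimension \<open>m = 2d\<close>, and the claim becomes a fractional
  Helly theorem, with Helly number \<open>m + 1\<close>, for convex sets that are intersected with the
  ground set of integer pairs with \<open>v \<noteq> 0\<close>. All constants below are independent of \<open>k\<close>. Only finitely many
  pairs matter, so the ground set may be cut down to a finite set \<open>T\<close>.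

  The only property of \<open>T\<close> that is used is that among more than \<open>h\<close> of its points there are two
  with another point of \<open>T\<close> strictly between them (\<open>segment_rich\<close>). For the pairs above this holds since two points
  that agree modulo 3 have two integer points at the thirds of their segment, and at most one of these has \<open>v = 0\<close>.
  The property gives \<open>T\<close> the Helly number \<open>h\<close> (\<open>helly_halfspaces\<close>), by Bell's and Scarf's argument
  for the integer lattice.

  Helly number \<open>h\<close> yields a fractional Helly theorem for \<open>h\<close>-tuples in the classical way: order \<open>T\<close>
  suitably; the last point of \<open>T\<close> in an intersection of sets is
  already determined by fewer than \<open>h\<close> of these sets (\<open>last_point_determined\<close>), so by pigeonhole
  a single last point lies in a positive fraction of all sets (\<open>rich_tuples_give_deep_point\<close>).

  The heart of the matter is to pass from \<open>m + 1\<close> to the much larger number \<open>h\<close>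
  (\<open>colour_class_meets\<close>). Take \<open>m + 1\<close> colour classes of \<open>N\<close> sets each, such that any choice of one set
  per class has a common point in \<open>T\<close>. If no \<open>h\<close> sets of one class have a common point in \<open>T\<close>, then for every
  choice of \<open>h\<close> sets in a class, Helly's theorem gives at most \<open>h\<close> halfspaces, each around one of
  these sets, that have no common point in \<open>T\<close>. So every common point of a transversal
  lies outside of one of them. After an application of Ramsey's theorem the choice of this halfspace no longer
  depends on the sets of the transversal in the other classes. One finds one halfspace
  and two sets for each class, such that a transversal through these sets has its common point inside the
  halfspace of a class or outside of it, depending on which of the two sets was chosen there. But \<open>m + 1\<close> halfspaces in dimension
  \<open>m\<close> do not have all \<open>2 ^ (m + 1)\<close> sign patterns (\<open>no_full_sign_pattern\<close>).

  Finally, a dense set of \<open>(m + 1)\<close>-tuples contains a positive fraction of all complete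
  \<open>(m + 1)\<close>-partite grids (\<open>many_grids\<close>), and each of them contains \<open>h\<close> sets with a common point in \<open>T\<close>.
\<close>

section \<open>Helly's theorem relative to a finite ground set\<close>

text \<open>A discrete form of having a bounded Helly number: more than \<open>h\<close> points of \<open>T\<close> are never the only
  points of \<open>T\<close> in their convex hull, and the additional point can be seen on a segment.\<close>

definition segment_rich :: "nat \<Rightarrow> 'a::euclidean_space set \<Rightarrow> bool" where
  "segment_rich h T \<longleftrightarrow>
     (\<forall>X\<subseteq>T. card X > h \<longrightarrow> (\<exists>x\<in>X. \<exists>y\<in>X. x \<noteq> y \<and> T \<inter> open_segment x y \<noteq> {}))"

text \<open>Move the bounding hyperplanes of a minimal family of halfspaces outwards, one at a time, until each of them
  hits a point of \<open>T\<close> that lies in all the other halfspaces. Moving a hyperplane only enlarges its halfspace, so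
  the witnesses of the hyperplanes that were moved before stay valid. The halfspaces are
  open, so the point that a hyperplane reaches first is still cut off, and the intersection stays free of \<open>T\<close>.\<close>

lemma push_thresholds:
  fixes a :: "'l \<Rightarrow> 'a::euclidean_space" and b :: "'l \<Rightarrow> real"
  assumes T: "finite T" and M: "finite M" "M \<subseteq> L"
    and cover: "\<forall>s\<in>T. \<exists>l\<in>L. b l \<le> a l \<bullet> s"
    and minimal: "\<forall>l\<in>L. \<exists>s\<in>T. \<forall>j\<in>L - {l}. a j \<bullet> s < b j"
  shows "\<exists>b'. (\<forall>s\<in>T. \<exists>l\<in>L. b' l \<le> a l \<bullet> s) \<and>
    (\<forall>l\<in>L. \<exists>s\<in>T. \<forall>j\<in>L - {l}. a j \<bullet> s < b' j) \<and>
    (\<forall>l\<in>M. \<exists>s\<in>T. a l \<bullet> s = b' l \<and> (\<forall>j\<in>L - {l}. a j \<bullet> s < b' j))"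
  using M
proof (induction M rule: finite_induct)
  case empty
  then show ?case using cover minimal by blast
next
  case (insert l M)
  then obtain b' where b': "\<forall>s\<in>T. \<exists>l\<in>L. b' l \<le> a l \<bullet> s"
      "\<forall>l\<in>L. \<exists>s\<in>T. \<forall>j\<in>L - {l}. a j \<bullet> s < b' j"
      "\<forall>l\<in>M. \<exists>s\<in>T. a l \<bullet> s = b' l \<and> (\<forall>j\<in>L - {l}. a j \<bullet> s < b' j)"
    by auto
  have lL: "l \<in> L" using insert by simp
  define R where "R = {s\<in>T. \<forall>j\<in>L - {l}. a j \<bullet> s < b' j}"
  have R: "finite R" "R \<noteq> {}" using T b'(2) lL by (auto simp: R_def)
  define t where "t = Min ((\<lambda>s. a l \<bullet> s) ` R)"
  have t_le: "t \<le> a l \<bullet> s" if "s \<in> R" for s using that R by (auto simp: t_def)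
  obtain p where p: "p \<in> R" "a l \<bullet> p = t"
  proof -
    have "t \<in> (\<lambda>s. a l \<bullet> s) ` R" unfolding t_def using R by (intro Min_in) auto
    then show ?thesis using that by auto
  qed
  have "b' l \<le> t"
  proof -
    obtain k where "k \<in> L" "b' k \<le> a k \<bullet> p" using b'(1) p by (auto simp: R_def)
    moreover have "\<not> b' k \<le> a k \<bullet> p" if "k \<noteq> l"
      using p(1) \<open>k \<in> L\<close> that by (auto simp: R_def not_le)
    ultimately show ?thesis using p(2) by (cases "k = l") auto
  qed
  then have mono: "b' j \<le> (b'(l := t)) j" for j by simp
  show ?case
  proof (intro exI[of _ "b'(l := t)"] conjI ballI)
    fix s assume s: "s \<in> T"
    show "\<exists>k\<in>L. (b'(l := t)) k \<le> a k \<bullet> s"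
    proof (cases "s \<in> R")
      case True
      then show ?thesis using t_le lL by (intro bexI[of _ l]) auto
    next
      case False
      then obtain j where "j \<in> L" "j \<noteq> l" "b' j \<le> a j \<bullet> s" using s by (auto simp: R_def not_less)
      then show ?thesis by (intro bexI[of _ j]) auto
    qed
  next
    fix k assume "k \<in> L"
    then obtain s where "s \<in> T" "\<forall>j\<in>L - {k}. a j \<bullet> s < b' j" using b'(2) by blast
    then show "\<exists>s\<in>T. \<forall>j\<in>L - {k}. a j \<bullet> s < (b'(l := t)) j"
      using mono by (meson less_le_trans)
  next
    fix k assume k: "k \<in> insert l M"
    show "\<exists>s\<in>T. a k \<bullet> s = (b'(l := t)) k \<and> (\<forall>j\<in>L - {k}. a j \<bullet> s < (b'(l := t)) j)"
    proof (cases "k = l")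
      case True
      then show ?thesis using p by (intro bexI[of _ p]) (auto simp: R_def)
    next
      case False
      then obtain s where "s \<in> T" "a k \<bullet> s = b' k" "\<forall>j\<in>L - {k}. a j \<bullet> s < b' j"
        using b'(3) k by blast
      then have "\<forall>j\<in>L - {k}. a j \<bullet> s < (b'(l := t)) j" using mono less_le_trans by blast
      then show ?thesis using \<open>s \<in> T\<close> \<open>a k \<bullet> s = b' k\<close> False by (intro bexI[of _ s]) auto
    qed
  qed
qed

text \<open>Helly's theorem for halfspaces relative to \<open>T\<close>. In a minimal family with too many members, push the
  hyperplanes outwards as far as possible. A point of \<open>T\<close> between two of the points that now block the
  hyperplanes is strictly inside of all halfspaces, since no two blocking points belong to the same hyperplane.\<close>

lemma helly_halfspaces:
  fixes a :: "'l \<Rightarrow> 'a::euclidean_space" and b :: "'l \<Rightarrow> real"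
  assumes T: "finite T" "segment_rich h T" and L: "finite L"
    and cover: "\<forall>s\<in>T. \<exists>l\<in>L. b l \<le> a l \<bullet> s"
  shows "\<exists>L'\<subseteq>L. card L' \<le> h \<and> (\<forall>s\<in>T. \<exists>l\<in>L'. b l \<le> a l \<bullet> s)"
proof -
  define good where "good K \<longleftrightarrow> K \<subseteq> L \<and> (\<forall>s\<in>T. \<exists>l\<in>K. b l \<le> a l \<bullet> s)" for K
  have "good L" using cover by (simp add: good_def)
  then obtain K where K: "good K" and min: "\<And>K'. good K' \<Longrightarrow> card K \<le> card K'"
    by (metis arg_min_natI arg_min_nat_le)
  have finK: "finite K" using K L finite_subset by (auto simp: good_def)
  have "\<exists>s\<in>T. \<forall>j\<in>K - {l}. a j \<bullet> s < b j" if "l \<in> K" for l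
  proof (rule ccontr)
    assume "\<not> ?thesis"
    then have "good (K - {l})" using K by (auto simp: good_def not_less)
    from min[OF this] show False using that finK by (metis card_Diff1_less leD)
  qed
  then have "\<forall>l\<in>K. \<exists>s\<in>T. \<forall>j\<in>K - {l}. a j \<bullet> s < b j" by blast
  from push_thresholds[OF T(1) finK order_refl _ this] K
  obtain b' where b': "\<forall>s\<in>T. \<exists>l\<in>K. b' l \<le> a l \<bullet> s"
      "\<forall>l\<in>K. \<exists>s\<in>T. a l \<bullet> s = b' l \<and> (\<forall>j\<in>K - {l}. a j \<bullet> s < b' j)"
    by (auto simp: good_def)
  then obtain p where p: "\<And>l. l \<in> K \<Longrightarrow> p l \<in> T" "\<And>l. l \<in> K \<Longrightarrow> a l \<bullet> p l = b' l"
      "\<And>l j. l \<in> K \<Longrightarrow> j \<in> K \<Longrightarrow> j \<noteq> l \<Longrightarrow> a j \<bullet> p l < b' j"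
    by (metis DiffI empty_iff insert_iff)
  have "card K \<le> h"
  proof (rule ccontr)
    assume "\<not> card K \<le> h"
    moreover have inj: "inj_on p K" using p by (metis inj_onI less_irrefl)
    ultimately have "card (p ` K) > h" by (simp add: card_image)
    moreover have "p ` K \<subseteq> T" using p by auto
    ultimately have "\<exists>x\<in>p ` K. \<exists>y\<in>p ` K. x \<noteq> y \<and> T \<inter> open_segment x y \<noteq> {}"
      by (intro T(2)[unfolded segment_rich_def, rule_format])
    then obtain i j where ij: "i \<in> K" "j \<in> K" "p i \<noteq> p j" "T \<inter> open_segment (p i) (p j) \<noteq> {}"
      by auto
    then obtain s where s: "s \<in> T" "s \<in> open_segment (p i) (p j)" by auto
    then obtain u where u: "0 < u" "u < 1" "s = (1 - u) *\<^sub>R p i + u *\<^sub>R p j"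
      by (auto simp: in_segment)
    \<comment> \<open>the two blocking points do not both lie on the hyperplane of \<open>l\<close>, so \<open>s\<close> is strictly inside\<close>
    have "a l \<bullet> s < b' l" if l: "l \<in> K" for l
    proof -
      have le: "a l \<bullet> p k \<le> b' l" if "k \<in> K" for k using p l that by (cases "k = l") (auto simp: less_imp_le)
      have "a l \<bullet> p i < b' l \<or> a l \<bullet> p j < b' l" 
        using ij p(3)[of i l] p(3)[of j l] l by auto
      moreover have "a l \<bullet> s = (1 - u) * (a l \<bullet> p i) + u * (a l \<bullet> p j)"
        by (simp add: u inner_add_right)
      moreover have "(1 - u) * (a l \<bullet> p i) \<le> (1 - u) * b' l" "u * (a l \<bullet> p j) \<le> u * b' l"
        using le ij u by (auto intro!: mult_left_mono)
      moreover have "a l \<bullet> p i < b' l \<Longrightarrow> (1 - u) * (a l \<bullet> p i) < (1 - u) * b' l"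
        "a l \<bullet> p j < b' l \<Longrightarrow> u * (a l \<bullet> p j) < u * b' l" using u by auto
      moreover have "(1 - u) * b' l + u * b' l = b' l" by (simp add: algebra_simps)
      ultimately show ?thesis by linarith
    qed
    then show False using b'(1) s by (meson not_less)
  qed
  then show ?thesis using K by (auto simp: good_def)
qed

lemma separate_from_finite:
  fixes s :: "'a::euclidean_space"
  assumes "finite A" "s \<notin> convex hull A"
  shows "\<exists>a b. (\<forall>x\<in>A. a \<bullet> x < b) \<and> b \<le> a \<bullet> s"
proof -
  have "closed (convex hull A)" using assms finite_imp_compact_convex_hull compact_imp_closed by blast
  from separating_hyperplane_closed_point[OF convex_convex_hull this assms(2)]
  obtain a b where "a \<bullet> s < b" "\<forall>x\<in>convex hull A. a \<bullet> x > b" by blast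
  then show ?thesis by (intro exI[of _ "-a"] exI[of _ "-b"]) (auto simp: hull_inc)
qed

text \<open>Helly's theorem for arbitrary convex traces, with separating halfspaces. A halfspace is
  labelled by the set that it contains (its owner) and by the point of \<open>T\<close> that it cuts off from this set; one set may
  own several of the chosen halfspaces.\<close>

lemma helly_owners:
  fixes D :: "'k \<Rightarrow> 'a::euclidean_space set"
  assumes T: "finite T" "segment_rich h T" and K: "finite K"
    and conv: "\<forall>k\<in>K. T \<inter> convex hull (T \<inter> D k) \<subseteq> D k"
    and empty: "\<forall>s\<in>T. \<exists>k\<in>K. s \<notin> D k"
  shows "\<exists>(L :: ('k \<times> 'a) set) a b. finite L \<and> card L \<le> h \<and> fst ` L \<subseteq> K \<and>
    (\<forall>l\<in>L. \<forall>x\<in>T \<inter> D (fst l). a l \<bullet> x < b l) \<and> (\<forall>s\<in>T. \<exists>l\<in>L. b l \<le> a l \<bullet> s)"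
proof -
  define L where "L = {(k, s). k \<in> K \<and> s \<in> T \<and> s \<notin> D k}"
  have "L \<subseteq> K \<times> T" by (auto simp: L_def)
  then have finL: "finite L" using T K finite_subset by blast
  have "\<exists>a b. (\<forall>x\<in>T \<inter> D (fst l). a \<bullet> x < b) \<and> b \<le> a \<bullet> snd l" if "l \<in> L" for l
  proof (rule separate_from_finite)
    show "finite (T \<inter> D (fst l))" using T by simp
    show "snd l \<notin> convex hull (T \<inter> D (fst l))"
      using that bspec[OF conv, of "fst l"] by (auto simp: L_def)
  qed
  then obtain a b where ab: "\<And>l. l \<in> L \<Longrightarrow> (\<forall>x\<in>T \<inter> D (fst l). a l \<bullet> x < b l) \<and> b l \<le> a l \<bullet> snd l"
    by metis
  have "\<forall>s\<in>T. \<exists>l\<in>L. b l \<le> a l \<bullet> s"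
  proof
    fix s assume "s \<in> T"
    with empty obtain k where "(k, s) \<in> L" by (auto simp: L_def)
    then show "\<exists>l\<in>L. b l \<le> a l \<bullet> s" using ab by force
  qed
  from helly_halfspaces[OF T finL this] obtain L' where "L' \<subseteq> L" "card L' \<le> h"
    "\<forall>s\<in>T. \<exists>l\<in>L'. b l \<le> a l \<bullet> s" by blast
  moreover have "fst ` L' \<subseteq> K" using \<open>L' \<subseteq> L\<close> by (auto simp: L_def)
  moreover have "finite L'" using \<open>L' \<subseteq> L\<close> finL by (rule finite_subset)
  moreover have "\<forall>l\<in>L'. \<forall>x\<in>T \<inter> D (fst l). a l \<bullet> x < b l" 
  proof
    fix l assume "l \<in> L'"
    then show "\<forall>x\<in>T \<inter> D (fst l). a l \<bullet> x < b l" using ab[of l] \<open>L' \<subseteq> L\<close> by auto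
  qed
  ultimately show ?thesis by (intro exI[of _ L'] exI[of _ a] exI[of _ b]) simp
qed

section \<open>The last common point of convex sets\<close>

text \<open>Remove extreme points one after another. This orders \<open>T\<close> such that the points after a given one
  are the trace of a convex set on \<open>T\<close>, without a choice of a generic linear functional.\<close>

lemma peeling_order_exists:
  fixes T :: "'a::euclidean_space set"
  assumes "finite T"
  shows "\<exists>\<rho>::'a \<Rightarrow> nat. inj_on \<rho> T \<and> (\<forall>p\<in>T. p \<notin> convex hull {s\<in>T. \<rho> s > \<rho> p})"
  using assms
proof (induction "card T" arbitrary: T)
  case 0
  then show ?case by simp
next
  case (Suc n)
  then have "T \<noteq> {}" by auto
  moreover have "compact (convex hull T)" using Suc finite_imp_compact_convex_hull by blast
  ultimately obtain e where e: "e extreme_point_of (convex hull T)"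
    using extreme_point_exists_convex[of "convex hull T"] by auto
  then have eT: "e \<in> T" using extreme_point_of_convex_hull by blast
  have "convex (convex hull T - {e})" using e extreme_point_of_stillconvex by blast
  moreover have "T - {e} \<subseteq> convex hull T - {e}" by (auto simp: hull_inc)
  ultimately have "convex hull (T - {e}) \<subseteq> convex hull T - {e}" by (simp add: hull_minimal)
  then have ne: "e \<notin> convex hull (T - {e})" by auto
  have "n = card (T - {e})" "finite (T - {e})" using Suc eT by auto
  from Suc.hyps(1)[OF this] obtain \<rho> :: "'a \<Rightarrow> nat" where \<rho>: "inj_on \<rho> (T - {e})"
    "\<forall>p\<in>T - {e}. p \<notin> convex hull {s\<in>T - {e}. \<rho> s > \<rho> p}" by blast
  define \<tau> where "\<tau> s = (if s = e then 0 else Suc (\<rho> s))" for s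
  show ?case
  proof (intro exI[of _ \<tau>] conjI ballI)
    show "inj_on \<tau> T" using \<rho>(1) by (auto simp: inj_on_def \<tau>_def)
    fix p assume p: "p \<in> T"
    show "p \<notin> convex hull {s\<in>T. \<tau> s > \<tau> p}"
    proof (cases "p = e")
      case True
      then have "{s\<in>T. \<tau> s > \<tau> p} = T - {e}" by (auto simp: \<tau>_def)
      then show ?thesis using ne True by simp
    next
      case False
      then have "{s\<in>T. \<tau> s > \<tau> p} = {s\<in>T - {e}. \<rho> s > \<rho> p}" by (auto simp: \<tau>_def)
      then show ?thesis using \<rho>(2) p False by simp
    qed
  qed
qed

text \<open>The points after \<open>p\<close> form one more convex trace, which has no point in common with all the sets
  \<open>C k\<close>. Among the at most \<open>h\<close> sets that suffice for an empty intersection there must be this one,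
  since \<open>p\<close> lies in all the others. So fewer than \<open>h\<close> of the sets \<open>C k\<close> remain.\<close>

lemma last_point_determined:
  fixes T :: "'a::euclidean_space set" and C :: "'k \<Rightarrow> 'a set" and \<rho> :: "'a \<Rightarrow> nat"
  assumes T: "finite T" "segment_rich h T" and J: "finite J" "\<And>k. k \<in> J \<Longrightarrow> convex (C k)"
    and \<rho>: "\<forall>p\<in>T. p \<notin> convex hull {s\<in>T. \<rho> s > \<rho> p}"
    and p: "p \<in> T" "\<forall>k\<in>J. p \<in> C k"
    and last: "\<forall>s\<in>T. (\<forall>k\<in>J. s \<in> C k) \<longrightarrow> \<rho> s \<le> \<rho> p"
  shows "\<exists>J'\<subseteq>J. card J' < h \<and> (\<forall>s\<in>T. (\<forall>k\<in>J'. s \<in> C k) \<longrightarrow> \<rho> s \<le> \<rho> p)"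
proof -
  define later where "later = {s\<in>T. \<rho> s > \<rho> p}"
  define D where "D k = (case k of None \<Rightarrow> later | Some k \<Rightarrow> C k)" for k
  define K where "K = insert None (Some ` J)"
  have conv: "\<forall>k\<in>K. T \<inter> convex hull (T \<inter> D k) \<subseteq> D k"
  proof
    fix k assume k: "k \<in> K"
    show "T \<inter> convex hull (T \<inter> D k) \<subseteq> D k"
    proof (cases k)
      case None
      have "q \<in> later" if q: "q \<in> T" "q \<in> convex hull later" for q
      proof (rule ccontr)
        assume "q \<notin> later"
        then have "later \<subseteq> {s\<in>T. \<rho> s > \<rho> q}" using q by (auto simp: later_def)
        then have "q \<in> convex hull {s\<in>T. \<rho> s > \<rho> q}" using q hull_mono by blast
        then show False using \<rho> q by blast
      qed
      then show ?thesis using None by (auto simp: D_def later_def Int_def)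
    next
      case (Some j)
      then have "convex (C j)" using k J by (auto simp: K_def)
      then have "convex hull (T \<inter> C j) \<subseteq> C j" by (simp add: hull_minimal)
      then show ?thesis using Some by (auto simp: D_def)
    qed
  qed
  have "\<forall>s\<in>T. \<exists>k\<in>K. s \<notin> D k"
    using last by (fastforce simp: K_def D_def later_def)
  from helly_owners[OF T _ conv this] J obtain L :: "('k option \<times> 'a) set" and a b
    where L: "finite L" "card L \<le> h" "fst ` L \<subseteq> K"
    "\<forall>l\<in>L. \<forall>x\<in>T \<inter> D (fst l). a l \<bullet> x < b l" "\<forall>s\<in>T. \<exists>l\<in>L. b l \<le> a l \<bullet> s"
    by (auto simp: K_def)
  obtain l0 where l0: "l0 \<in> L" "b l0 \<le> a l0 \<bullet> p" using L(5) p by blast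
  have "p \<notin> D (fst l0)" using L(4) l0 p by force
  then have "fst l0 = None" using L(3) l0 p by (force simp: D_def K_def)
  define J' where "J' = {j. Some j \<in> fst ` L}"
  have "J' \<subseteq> J" using L(3) by (auto simp: J'_def K_def)
  moreover have "card J' < h"
  proof -
    have "Some ` J' \<subseteq> fst ` (L - {l0})" using \<open>fst l0 = None\<close> by (force simp: J'_def)
    then have "card J' \<le> card (fst ` (L - {l0}))"
      by (metis L(1) card_image card_mono finite_Diff finite_imageI inj_Some inj_on_subset subset_UNIV)
    also have "\<dots> \<le> card (L - {l0})" using L(1) by (intro card_image_le) auto
    also have "\<dots> < card L" using l0 L(1) by (intro card_Diff1_less) auto
    finally show ?thesis using L(2) by simp
  qed
  moreover have "\<rho> s \<le> \<rho> p" if s: "s \<in> T" "\<forall>k\<in>J'. s \<in> C k" for s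
  proof -
    obtain l where l: "l \<in> L" "b l \<le> a l \<bullet> s" using L(5) s by blast
    then have "s \<notin> D (fst l)" using L(4) s by force
    moreover have "s \<in> D (fst l)" if "fst l = Some j" for j
      using that s(2) l(1) by (force simp: J'_def D_def)
    ultimately have "fst l = None" by (cases "fst l") auto
    then show ?thesis using \<open>s \<notin> D (fst l)\<close> s by (auto simp: D_def later_def)
  qed
  ultimately show ?thesis by (intro exI[of _ J']) simp
qed

section \<open>Sign patterns of halfspaces\<close>

text \<open>The normals of \<open>m + 1\<close> halfspaces in dimension \<open>m\<close> satisfy a linear relation with coefficients \<open>w\<close>. Hence
  the combination of the affine functionals with coefficients \<open>w\<close> is constant, whereas a point whose
  signs agree with those of \<open>w\<close> and a point with the opposite signs make it nonnegative and nonpositive, and not both zero.\<close>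

lemma no_full_sign_pattern:
  fixes a :: "nat \<Rightarrow> 'a::euclidean_space" and b :: "nat \<Rightarrow> real"
  shows "\<not> (\<forall>\<sigma>::nat \<Rightarrow> bool. \<exists>x. \<forall>c\<le>DIM('a). a c \<bullet> x < b c \<longleftrightarrow> \<sigma> c)"
proof
  assume full: "\<forall>\<sigma>::nat \<Rightarrow> bool. \<exists>x. \<forall>c\<le>DIM('a). a c \<bullet> x < b c \<longleftrightarrow> \<sigma> c"
  have "\<exists>w. (\<exists>c\<le>DIM('a). w c \<noteq> (0::real)) \<and> (\<Sum>c\<le>DIM('a). w c *\<^sub>R a c) = 0"
  proof (cases "inj_on a {..DIM('a)}")
    case True
    then have "dependent (a ` {..DIM('a)})" by (intro dependent_biggerset) (simp add: card_image)
    then obtain u where u: "\<exists>v\<in>a ` {..DIM('a)}. u v \<noteq> 0" "(\<Sum>v\<in>a ` {..DIM('a)}. u v *\<^sub>R v) = 0"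
      by (auto simp: dependent_finite)
    then show ?thesis using True by (intro exI[of _ "u \<circ> a"]) (auto simp: sum.reindex)
  next
    case False
    then obtain i j where ij: "i \<le> DIM('a)" "j \<le> DIM('a)" "i \<noteq> j" "a i = a j" by (auto simp: inj_on_def)
    define w where "w = (\<lambda>c. if c = i then 1 else if c = j then -1 else (0::real))"
    have "(\<Sum>c\<le>DIM('a). w c *\<^sub>R a c) = (\<Sum>c\<in>{i,j}. w c *\<^sub>R a c)"
      by (rule sum.mono_neutral_right) (use ij in \<open>auto simp: w_def\<close>)
    also have "\<dots> = 0" using ij by (simp add: w_def)
    finally show ?thesis using ij by (intro exI[of _ w]) (auto simp: w_def)
  qed
  then obtain w where w: "\<exists>c\<le>DIM('a). w c \<noteq> (0::real)" "(\<Sum>c\<le>DIM('a). w c *\<^sub>R a c) = 0" by blast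
  have eq: "(\<Sum>c\<le>DIM('a). w c * (a c \<bullet> x - b c)) = - (\<Sum>c\<le>DIM('a). w c * b c)" for x
  proof -
    have "(\<Sum>c\<le>DIM('a). w c * (a c \<bullet> x)) = (\<Sum>c\<le>DIM('a). w c *\<^sub>R a c) \<bullet> x"
      by (simp add: inner_sum_left)
    then show ?thesis by (simp add: w right_diff_distrib sum_subtractf)
  qed
  obtain x where x: "\<forall>c\<le>DIM('a). a c \<bullet> x < b c \<longleftrightarrow> w c < 0"
    using spec[OF full, of "\<lambda>c. w c < 0"] by (elim exE)
  obtain y where y: "\<forall>c\<le>DIM('a). a c \<bullet> y < b c \<longleftrightarrow> w c > 0"
    using spec[OF full, of "\<lambda>c. w c > 0"] by (elim exE)
  have nonneg: "0 \<le> w c * (a c \<bullet> x - b c)" and nonpos: "w c * (a c \<bullet> y - b c) \<le> 0" if "c \<le> DIM('a)" for c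
  proof -
    have "a c \<bullet> x < b c \<longleftrightarrow> w c < 0" "a c \<bullet> y < b c \<longleftrightarrow> w c > 0" using x y that by blast+
    then have "w c < 0 \<and> a c \<bullet> x - b c \<le> 0 \<or> 0 \<le> w c \<and> 0 \<le> a c \<bullet> x - b c"
      "w c \<le> 0 \<and> 0 \<le> a c \<bullet> y - b c \<or> 0 \<le> w c \<and> a c \<bullet> y - b c \<le> 0" by linarith+
    then show "0 \<le> w c * (a c \<bullet> x - b c)" "w c * (a c \<bullet> y - b c) \<le> 0"
      by (meson less_imp_le mult_nonneg_nonneg mult_nonpos_nonpos,
          meson less_imp_le mult_nonneg_nonpos mult_nonpos_nonneg)
  qed
  have "0 \<le> (\<Sum>c\<le>DIM('a). w c * (a c \<bullet> x - b c))" using nonneg by (intro sum_nonneg) auto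
  moreover have "(\<Sum>c\<le>DIM('a). w c * (a c \<bullet> y - b c)) \<le> 0" using nonpos by (intro sum_nonpos) auto
  ultimately have x0: "(\<Sum>c\<le>DIM('a). w c * (a c \<bullet> x - b c)) = 0"
    and y0: "(\<Sum>c\<le>DIM('a). - (w c * (a c \<bullet> y - b c))) = 0"
    unfolding eq sum_negf by auto
  obtain c where c: "c \<le> DIM('a)" "w c \<noteq> 0" using w by blast
  have "w c * (a c \<bullet> x - b c) = 0"
    by (rule sum_nonneg_0[OF _ _ x0]) (use nonneg c in auto)
  moreover have "- (w c * (a c \<bullet> y - b c)) = 0"
    by (rule sum_nonneg_0[OF _ _ y0]) (use nonpos c in auto)
  ultimately have "a c \<bullet> x = b c" "a c \<bullet> y = b c" using c by auto
  then have "\<not> w c < 0" "\<not> w c > 0" using x y c by fastforce+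
  then show False using c by simp
qed

section \<open>A colour class with many intersecting sets\<close>

lemma ramsey_finite_colours:
  assumes "finite K"
  shows "\<exists>N>(0::nat). \<forall>f. f \<in> nsets {..<N} r \<rightarrow> K \<longrightarrow>
    (\<exists>H\<in>nsets {..<N} s. \<exists>k. \<forall>X\<in>nsets H r. f X = k)"
proof -
  obtain e where e: "bij_betw e K {..<card K}"
    using ex_bij_betw_finite_nat[OF assms] by (auto simp: atLeast0LessThan)
  obtain N :: nat where "partn_lst {..<N} (replicate (card K) s) r" using ramsey_full by blast
  then have N: "partn_lst {..<Suc N} (replicate (card K) s) r"
    by (rule partn_lst_greater_resource) simp
  have "\<exists>H\<in>nsets {..<Suc N} s. \<exists>k. \<forall>X\<in>nsets H r. f X = k" if f: "f \<in> nsets {..<Suc N} r \<rightarrow> K" for f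
  proof -
    have "(\<lambda>X. e (f X)) \<in> nsets {..<Suc N} r \<rightarrow> {..<card K}"
      using f bij_betwE[OF e] by (auto simp: Pi_iff)
    with N obtain i H where i: "i < card K" and H: "H \<in> nsets {..<Suc N} s"
      and mono: "(\<lambda>X. e (f X)) ` nsets H r \<subseteq> {i}"
      unfolding partn_lst_def monochromatic_def by fastforce
    have "f X = inv_into K e i" if X: "X \<in> nsets H r" for X
    proof -
      have "H \<subseteq> {..<Suc N}" using H by (auto simp: nsets_def)
      then have "X \<in> nsets {..<Suc N} r" using X nsets_mono by blast
      then have "f X \<in> K" using f by (auto simp: Pi_iff)
      moreover have "e (f X) = i" using mono X by auto
      ultimately show ?thesis using e by (metis bij_betw_def inv_into_f_f)
    qed
    then show ?thesis using H by blast
  qed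
  then show ?thesis by (intro exI[of _ "Suc N"]) simp
qed

text \<open>The halfspaces of \<open>helly_owners\<close>, enumerated by exactly the numbers below \<open>h\<close> (with
  repetitions if there are fewer of them), so that a halfspace can serve as one of boundedly many colours.\<close>

lemma separating_halfspaces:
  fixes C :: "nat \<Rightarrow> 'a::euclidean_space set"
  assumes T: "finite T" "segment_rich h T" and J: "finite J" "J \<noteq> {}" "\<And>k. k \<in> J \<Longrightarrow> convex (C k)"
    and empty: "\<forall>s\<in>T. \<exists>k\<in>J. s \<notin> C k"
  shows "\<exists>owner a b. (\<forall>l<h. owner l \<in> J \<and> (\<forall>x\<in>T \<inter> C (owner l). a l \<bullet> x < b l)) \<and>
    (\<forall>s\<in>T. \<exists>l<h. b l \<le> a l \<bullet> s)"
proof (cases "T = {}")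
  case True
  then show ?thesis using J(2) by (intro exI[of _ "\<lambda>_. SOME k. k \<in> J"]) (auto simp: some_in_eq)
next
  case False
  have "convex hull (T \<inter> C k) \<subseteq> C k" if "k \<in> J" for k
    using J(3)[OF that] by (simp add: hull_minimal)
  then have conv: "\<forall>k\<in>J. T \<inter> convex hull (T \<inter> C k) \<subseteq> C k" by blast
  obtain L :: "(nat \<times> 'a) set" and a b where L: "finite L" "card L \<le> h" "fst ` L \<subseteq> J"
    "\<forall>l\<in>L. \<forall>x\<in>T \<inter> C (fst l). a l \<bullet> x < b l" "\<forall>s\<in>T. \<exists>l\<in>L. b l \<le> a l \<bullet> s"
    using helly_owners[OF T J(1) conv empty] by (elim exE conjE)
  have "L \<noteq> {}" using L(5) False by auto
  obtain e where e: "bij_betw e {..<card L} L"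
    using ex_bij_betw_nat_finite[OF L(1)] by (auto simp: atLeast0LessThan)
  define g where "g l = (if l < card L then e l else (SOME x. x \<in> L))" for l
  have g: "g l \<in> L" for l using bij_betwE[OF e] \<open>L \<noteq> {}\<close> by (auto simp: g_def some_in_eq)
  have "\<exists>l<h. b (g l) \<le> a (g l) \<bullet> s" if "s \<in> T" for s
  proof -
    obtain k where k: "k \<in> L" "b k \<le> a k \<bullet> s" using L(5) \<open>s \<in> T\<close> by blast
    then obtain l where l: "l < card L" "e l = k" using e by (metis bij_betw_iff_bijections lessThan_iff)
    then show ?thesis using k L(2) by (intro exI[of _ l]) (auto simp: g_def)
  qed
  moreover have "fst (g l) \<in> J" "\<forall>x\<in>T \<inter> C (fst (g l)). a (g l) \<bullet> x < b (g l)" for l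
    using g L(3,4) by auto
  ultimately show ?thesis
    by (intro exI[of _ "\<lambda>l. fst (g l)"] exI[of _ "\<lambda>l. a (g l)"] exI[of _ "\<lambda>l. b (g l)"]) simp
qed

text \<open>Ramsey's theorem speaks about sets of numbers. The set of size \<open>m + h\<close> that is coloured encodes one index
  for each class other than \<open>c\<close> and a block of \<open>h\<close> indices for the class \<open>c\<close>, in increasing order. The next two functions
  decode the sorted list of its elements: the block, and the transversal that uses the first index of the block.\<close>

definition spread_list :: "nat \<Rightarrow> nat \<Rightarrow> (nat \<Rightarrow> nat) \<Rightarrow> nat list \<Rightarrow> nat list" where
  "spread_list m c I block = map I [0..<c] @ block @ map I [Suc c..<Suc m]"

definition index_of :: "nat \<Rightarrow> nat \<Rightarrow> nat \<Rightarrow> nat list \<Rightarrow> nat \<Rightarrow> nat" where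
  "index_of m h c xs = (\<lambda>d\<in>{..m}. if d \<le> c then xs ! d else xs ! (d + h - 1))"

definition block_of :: "nat \<Rightarrow> nat \<Rightarrow> nat list \<Rightarrow> nat set" where
  "block_of h c xs = set (take h (drop c xs))"

lemma index_of_in_PiE:
  assumes "0 < h" "length xs = m + h" "set xs \<subseteq> {..<N}"
  shows "index_of m h c xs \<in> {..m} \<rightarrow>\<^sub>E {..<N}"
proof -
  have "xs ! i < N" if "i < m + h" for i
  proof -
    have "xs ! i \<in> set xs" using assms that by simp
    then show ?thesis using assms by blast
  qed
  then show ?thesis using assms by (auto simp: index_of_def)
qed

text \<open>Assume that no \<open>h\<close> sets of a class have a common point in \<open>T\<close>, and separate every
  block of \<open>h\<close> sets of each class by halfspaces. In a set that is homogeneous for the halfspaces that are missed, choose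
  consecutive blocks \<open>J 0 < \<dots> < J m\<close>. For a transversal that takes the first set of the block \<open>J c\<close>, the
  common point is outside of the halfspace number \<open>\<phi> c\<close> of this block, whatever sets are taken
  from the other blocks. For a transversal that takes the owner of that halfspace, the common point is inside. All
  sign patterns occur, which is impossible.\<close>

lemma colour_class_meets:
  assumes h: "0 < h"
  shows "\<exists>N>(0::nat). \<forall>(T :: 'a::euclidean_space set) C.
    finite T \<longrightarrow> segment_rich h T \<longrightarrow> (\<forall>c\<le>DIM('a). \<forall>i<N. convex (C c i)) \<longrightarrow>
    (\<forall>I\<in>{..DIM('a)} \<rightarrow>\<^sub>E {..<N}. \<exists>x\<in>T. \<forall>c\<le>DIM('a). x \<in> C c (I c)) \<longrightarrow>
    (\<exists>c\<le>DIM('a). \<exists>J\<subseteq>{..<N}. card J = h \<and> (\<exists>x\<in>T. \<forall>k\<in>J. x \<in> C c k))"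
proof -
  define m where "m = DIM('a)"
  define K where "K = {..m} \<rightarrow>\<^sub>E {..<h}"
  have "finite K" by (simp add: K_def finite_PiE)
  from ramsey_finite_colours[OF this, of "m + h" "Suc m * h"]
  obtain N :: nat where "N > 0" and ramsey: "\<And>f. f \<in> nsets {..<N} (m + h) \<rightarrow> K \<Longrightarrow>
    \<exists>H\<in>nsets {..<N} (Suc m * h). \<exists>k. \<forall>X\<in>nsets H (m + h). f X = k" by blast
  have core: "\<exists>c\<le>m. \<exists>J\<subseteq>{..<N}. card J = h \<and> (\<exists>x\<in>T. \<forall>k\<in>J. x \<in> C c k)"
    if T: "finite T" "segment_rich h T" and conv: "\<And>c i. c \<le> m \<Longrightarrow> i < N \<Longrightarrow> convex (C c i)"
      and trans: "\<And>I. I \<in> {..m} \<rightarrow>\<^sub>E {..<N} \<Longrightarrow> \<exists>x\<in>T. \<forall>c\<le>m. x \<in> C c (I c)"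
    for T :: "'a set" and C
  proof (rule ccontr)
    assume contra: "\<not> (\<exists>c\<le>m. \<exists>J\<subseteq>{..<N}. card J = h \<and> (\<exists>x\<in>T. \<forall>k\<in>J. x \<in> C c k))"
    define separates where "separates c J owner a b \<longleftrightarrow>
      (\<forall>l<h. owner l \<in> J \<and> (\<forall>x\<in>T \<inter> C c (owner l). a l \<bullet> x < b l)) \<and>
      (\<forall>s\<in>T. \<exists>l<h. b l \<le> a l \<bullet> s)" for c J and owner :: "nat \<Rightarrow> nat" and a :: "nat \<Rightarrow> 'a" and b :: "nat \<Rightarrow> real"
    have "\<exists>owner a b. separates c J owner a b" if "c \<le> m" "J \<subseteq> {..<N}" "card J = h" for c J
      unfolding separates_def
    proof (rule separating_halfspaces[OF T, of J "C c"])
      show "finite J" "J \<noteq> {}" using that h by (auto simp: finite_subset)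
      show "convex (C c k)" if "k \<in> J" for k using conv that \<open>c \<le> m\<close> \<open>J \<subseteq> {..<N}\<close> by auto
      show "\<forall>s\<in>T. \<exists>k\<in>J. s \<notin> C c k" using contra that by blast
    qed
    then obtain owner a b where sep: "\<And>c J. c \<le> m \<Longrightarrow> J \<subseteq> {..<N} \<Longrightarrow> card J = h \<Longrightarrow>
        separates c J (owner c J) (a c J) (b c J)" by metis
    have owner: "owner c J l \<in> J"
      and inside: "x \<in> T \<Longrightarrow> x \<in> C c (owner c J l) \<Longrightarrow> a c J l \<bullet> x < b c J l"
      if "c \<le> m" "J \<subseteq> {..<N}" "card J = h" "l < h" for c J l x
      using sep[OF that(1-3)] that(4) by (auto simp: separates_def)
    have outside: "\<exists>l<h. b c J l \<le> a c J l \<bullet> s"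
      if "c \<le> m" "J \<subseteq> {..<N}" "card J = h" "s \<in> T" for c J s
      using sep[OF that(1-3)] that(4) by (auto simp: separates_def)
    obtain X where X: "\<And>I. I \<in> {..m} \<rightarrow>\<^sub>E {..<N} \<Longrightarrow> X I \<in> T"
      "\<And>I c. I \<in> {..m} \<rightarrow>\<^sub>E {..<N} \<Longrightarrow> c \<le> m \<Longrightarrow> X I \<in> C c (I c)"
      using trans by metis
    \<comment> \<open>halfspace number \<open>l\<close> of the block misses the common point of the encoded transversal\<close>
    define missed where "missed c xs l \<longleftrightarrow> l < h \<and>
      b c (block_of h c xs) l \<le> a c (block_of h c xs) l \<bullet> X (index_of m h c xs)" for c xs l
    have missed_ex: "\<exists>l. missed c xs l" if c: "c \<le> m" and xs: "length xs = m + h" "set xs \<subseteq> {..<N}" "distinct xs" for c xs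
    proof -
      have "block_of h c xs \<subseteq> {..<N}"
        using xs(2) by (auto simp: block_of_def dest!: in_set_takeD in_set_dropD)
      moreover have "card (block_of h c xs) = h"
        using xs c by (simp add: block_of_def distinct_card)
      moreover have "index_of m h c xs \<in> {..m} \<rightarrow>\<^sub>E {..<N}"
        using xs h by (intro index_of_in_PiE)
      ultimately show ?thesis using outside[OF c] X(1) unfolding missed_def by blast
    qed
    define colour where "colour Y = (\<lambda>c\<in>{..m}. SOME l. missed c (sorted_list_of_set Y) l)" for Y
    have "colour \<in> nsets {..<N} (m + h) \<rightarrow> K"
    proof
      fix Y assume "Y \<in> nsets {..<N} (m + h)"
      then have "missed c (sorted_list_of_set Y) (colour Y c)" if "c \<le> m" for c
        using missed_ex[of c "sorted_list_of_set Y"] that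
        by (auto simp: colour_def nsets_def intro: someI)
      then show "colour Y \<in> K" by (auto simp: K_def missed_def colour_def)
    qed
    from ramsey[OF this] obtain H \<phi> where H: "H \<in> nsets {..<N} (Suc m * h)"
      and \<phi>: "\<And>Y. Y \<in> nsets H (m + h) \<Longrightarrow> colour Y = \<phi>" by blast
    define e where "e i = sorted_list_of_set H ! i" for i
    have finH: "finite H" "card H = Suc m * h" "H \<subseteq> {..<N}" using H by (auto simp: nsets_def)
    have e_mono: "e i < e j" if "i < j" "j < Suc m * h" for i j
      using that finH sorted_wrt_nth_less[OF strict_sorted_list_of_set, of i j H]
      by (simp add: e_def)
    have eH: "e i \<in> H" if "i < Suc m * h" for i
      using that finH nth_mem[of i "sorted_list_of_set H"] by (simp add: e_def)
    define block where "block c = map (\<lambda>j. e (c * h + j)) [0..<h]" for c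
    define J where "J c = set (block c)" for c
    have pos: "c * h + j < Suc m * h" if "c \<le> m" "j < h" for c j
    proof -
      have "c * h + j < Suc c * h" using that by simp
      also have "\<dots> \<le> Suc m * h" using that by (intro mult_right_mono) auto
      finally show ?thesis .
    qed
    have J_H: "J c \<subseteq> H" if "c \<le> m" for c using pos[OF that] eH by (auto simp: J_def block_def)
    have J_N: "J c \<subseteq> {..<N}" if "c \<le> m" for c using J_H[OF that] finH by blast
    have block_sorted: "sorted_wrt (<) (block c)" if "c \<le> m" for c
      unfolding block_def sorted_wrt_map
      by (rule sorted_wrt_mono_rel[OF _ sorted_wrt_upt]) (use pos[OF that] e_mono in auto)
    have J_card: "card (J c) = h" if "c \<le> m" for c
    proof -
      have "distinct (block c)" using block_sorted[OF that] by (simp add: strict_sorted_iff)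
      then have "card (J c) = length (block c)" unfolding J_def by (rule distinct_card)
      then show ?thesis by (simp add: block_def)
    qed
    have J_less: "x < y" if "x \<in> J c" "y \<in> J d" "c < d" "d \<le> m" for x y c d
    proof -
      from that(1) obtain i where i: "i < h" "x = e (c * h + i)" by (auto simp: J_def block_def)
      from that(2) obtain j where j: "j < h" "y = e (d * h + j)" by (auto simp: J_def block_def)
      have "c * h + i < Suc c * h" using i by simp
      also have "\<dots> \<le> d * h" using that by (intro mult_right_mono) auto
      finally have "c * h + i < d * h + j" by simp
      then show ?thesis using e_mono pos[of d j] i j that by simp
    qed
    have missed: "missed c (spread_list m c I (block c)) (\<phi> c)"
         "index_of m h c (spread_list m c I (block c)) = I"
         "block_of h c (spread_list m c I (block c)) = J c"
      if c: "c \<le> m" and I: "I \<in> {..m} \<rightarrow>\<^sub>E {..<N}" "\<And>d. d \<le> m \<Longrightarrow> I d \<in> J d" "I c = e (c * h)" for c I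
    proof -
      let ?xs = "spread_list m c I (block c)"
      have I_less: "I i < I j" if "i < j" "j \<le> m" for i j
        using J_less[OF I(2) I(2)] that by simp
      have len: "length ?xs = m + h" using c by (simp add: spread_list_def block_def)
      have sorted: "sorted_wrt (<) ?xs"
        unfolding spread_list_def sorted_wrt_append sorted_wrt_map
      proof (intro conjI ballI)
        show "sorted_wrt (\<lambda>i j. I i < I j) [0..<c]"
          by (rule sorted_wrt_mono_rel[OF _ sorted_wrt_upt]) (use c I_less in auto)
        show "sorted_wrt (\<lambda>i j. I i < I j) [Suc c..<Suc m]"
          by (rule sorted_wrt_mono_rel[OF _ sorted_wrt_upt]) (use c I_less in auto)
        show "sorted_wrt (<) (block c)" using block_sorted c by simp
        show "x < y" if "x \<in> set (block c)" "y \<in> set (map I [Suc c..<Suc m])" for x y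
        proof -
          from that(2) obtain j where "y = I j" "c < j" "j \<le> m" by auto
          then show ?thesis using that(1) I(2)[of j] J_less[of x c y j] by (simp add: J_def)
        qed
        show "x < y" if "x \<in> set (map I [0..<c])" "y \<in> set (block c @ map I [Suc c..<Suc m])" for x y
        proof -
          from that(1) obtain i where i: "x = I i" "i < c" by auto
          from that(2) consider "y \<in> J c" | j where "y = I j" "Suc c \<le> j" "j \<le> m" by (auto simp: J_def)
          then show ?thesis
          proof cases
            case 1 then show ?thesis using J_less[of x i y c] i I(2)[of i] c by auto
          next
            case 2 then show ?thesis using I_less[of i j] i by simp
          qed
        qed
      qed
      have sub: "set ?xs \<subseteq> H"
      proof -
        have "set ?xs = I ` {0..<c} \<union> J c \<union> I ` {Suc c..<Suc m}"
          unfolding spread_list_def J_def by (simp add: Un_assoc del: upt_Suc)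
        also have "\<dots> \<subseteq> J c \<union> I ` {..m}" using c by auto
        also have "\<dots> \<subseteq> H" using I(2) J_H c by blast
        finally show ?thesis .
      qed
      have xs_eq: "sorted_list_of_set (set ?xs) = ?xs"
        using sorted by (simp add: sorted_list_of_set.idem_if_sorted_distinct strict_sorted_iff)
      have "set ?xs \<in> nsets H (m + h)"
        using sub sorted len by (simp add: nsets_def strict_sorted_iff distinct_card)
      then have "colour (set ?xs) = \<phi>" by (rule \<phi>)
      then have "\<phi> c = (SOME l. missed c ?xs l)" using c by (auto simp: colour_def xs_eq)
      moreover have "\<exists>l. missed c ?xs l"
        using c len sub sorted finH by (intro missed_ex) (auto simp: strict_sorted_iff)
      ultimately show "missed c ?xs (\<phi> c)" by (metis someI_ex)
      show "block_of h c ?xs = J c"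
        using h by (simp add: block_of_def spread_list_def J_def block_def)
      show "index_of m h c ?xs = I"
      proof (rule PiE_ext[OF _ I(1)])
        show "index_of m h c ?xs \<in> {..m} \<rightarrow>\<^sub>E {..<N}"
          using len sub finH h by (intro index_of_in_PiE) auto
        fix d assume "d \<in> {..m}"
        then have d: "d \<le> m" by simp
        consider "d < c" | "d = c" | "c < d" by linarith
        then show "index_of m h c ?xs d = I d"
        proof cases
          case 1 then show ?thesis using d by (simp add: index_of_def spread_list_def nth_append)
        next
          case 2 then show ?thesis using d h I(3)
            by (simp add: index_of_def spread_list_def nth_append block_def)
        next
          case 3
          then have "\<not> d + h - 1 < c" "\<not> d + h - 1 - c < h" "d + h - 1 - c - h = d - Suc c"
            using h by auto
          then show ?thesis using 3 d
            by (simp add: index_of_def spread_list_def nth_append block_def del: upt_Suc)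
        qed
      qed
    qed
    \<comment> \<open>the halfspace contains its owner but not the point that the first set of the block contributes; so \<open>p c\<close> is not the first index\<close>
    define p where "p c = owner c (J c) (\<phi> c)" for c
    have full: "\<exists>x. \<forall>c\<le>m. a c (J c) (\<phi> c) \<bullet> x < b c (J c) (\<phi> c) \<longleftrightarrow> \<sigma> c" for \<sigma> :: "nat \<Rightarrow> bool"
    proof -
      have e_J: "e (c * h) \<in> J c" if "c \<le> m" for c using h by (force simp: J_def block_def)
      have J_lt: "x < N" if "x \<in> J c" "c \<le> m" for x c using J_N that by blast
      define I0 where "I0 = (\<lambda>c\<in>{..m}. e (c * h))"
      have I0: "I0 \<in> {..m} \<rightarrow>\<^sub>E {..<N}" "\<And>d. d \<le> m \<Longrightarrow> I0 d \<in> J d" 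
        using e_J J_lt[OF e_J] by (auto simp: I0_def)
      have \<phi>_h: "\<phi> c < h" if "c \<le> m" for c
        using missed(1)[OF that I0] that by (auto simp: I0_def missed_def)
      have p_J: "p c \<in> J c" if "c \<le> m" for c
        unfolding p_def using owner J_N J_card \<phi>_h that by simp
      define I where "I = (\<lambda>c\<in>{..m}. if \<sigma> c then p c else e (c * h))"
      have I: "I \<in> {..m} \<rightarrow>\<^sub>E {..<N}" "\<And>d. d \<le> m \<Longrightarrow> I d \<in> J d" 
        using e_J p_J J_lt[OF e_J] J_lt[OF p_J] by (auto simp: I_def)
      have "a c (J c) (\<phi> c) \<bullet> X I < b c (J c) (\<phi> c) \<longleftrightarrow> \<sigma> c" if c: "c \<le> m" for c
      proof (cases "\<sigma> c")
        case True
        then have "X I \<in> C c (owner c (J c) (\<phi> c))" using X(2)[OF I(1) c] c by (simp add: I_def p_def)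
        then show ?thesis using True inside[OF c J_N[OF c] J_card[OF c] \<phi>_h[OF c] X(1)[OF I(1)]] by simp
      next
        case False
        then have "I c = e (c * h)" using c by (simp add: I_def)
        from missed[OF c I this] show ?thesis using False by (simp add: missed_def not_less)
      qed
      then show ?thesis by blast
    qed
    have "\<forall>\<sigma>::nat \<Rightarrow> bool. \<exists>x. \<forall>c\<le>DIM('a). a c (J c) (\<phi> c) \<bullet> x < b c (J c) (\<phi> c) \<longleftrightarrow> \<sigma> c"
      using full unfolding m_def by (intro allI)
    then show False by (rule notE[OF no_full_sign_pattern])
  qed
  show ?thesis
  proof (rule exI[of _ N], intro conjI allI impI)
    fix T :: "'a set" and C :: "nat \<Rightarrow> nat \<Rightarrow> 'a set"
    assume T: "finite T" "segment_rich h T" and conv: "\<forall>c\<le>DIM('a). \<forall>i<N. convex (C c i)"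
      and trans: "\<forall>I\<in>{..DIM('a)} \<rightarrow>\<^sub>E {..<N}. \<exists>x\<in>T. \<forall>c\<le>DIM('a). x \<in> C c (I c)"
    show "\<exists>c\<le>DIM('a). \<exists>J\<subseteq>{..<N}. card J = h \<and> (\<exists>x\<in>T. \<forall>k\<in>J. x \<in> C c k)"
      unfolding m_def[symmetric]
    proof (rule core[OF T])
      show "convex (C c i)" if "c \<le> m" "i < N" for c i
        using conv that by (simp add: m_def)
      show "\<exists>x\<in>T. \<forall>c\<le>m. x \<in> C c (I c)" if "I \<in> {..m} \<rightarrow>\<^sub>E {..<N}" for I
        using trans that by (simp add: m_def)
    qed
  qed (rule \<open>N > 0\<close>)
qed

section \<open>Counting tuples and grids\<close>

definition tuples :: "'i set \<Rightarrow> nat \<Rightarrow> 'i list set" where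
  "tuples V n = {xs. set xs \<subseteq> V \<and> length xs = n}"

lemma in_tuples_iff: "xs \<in> tuples V n \<longleftrightarrow> set xs \<subseteq> V \<and> length xs = n"
  by (simp add: tuples_def)

lemma Cons_in_tuples_Suc: "z # xs \<in> tuples V (Suc n) \<longleftrightarrow> z \<in> V \<and> xs \<in> tuples V n"
  by (auto simp: tuples_def)

lemma finite_tuples: "finite V \<Longrightarrow> finite (tuples V n)"
  unfolding tuples_def by (rule finite_lists_length_eq)

lemma card_tuples: "finite V \<Longrightarrow> card (tuples V n) = card V ^ n"
  unfolding tuples_def by (rule card_lists_length_eq)

lemma card_tuples_Suc:
  assumes "finite V"
  shows "card {xs \<in> tuples V (Suc n). P xs} = (\<Sum>z\<in>V. card {xs \<in> tuples V n. P (z # xs)})"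
proof -
  have eq: "{xs \<in> tuples V (Suc n). P xs} = (\<Union>z\<in>V. (#) z ` {xs \<in> tuples V n. P (z # xs)})"
  proof (intro set_eqI iffI)
    fix ys assume "ys \<in> {xs \<in> tuples V (Suc n). P xs}"
    then obtain z zs where "ys = z # zs" "z \<in> V" "zs \<in> {xs \<in> tuples V n. P (z # xs)}"
      by (cases ys) (auto simp: in_tuples_iff)
    then show "ys \<in> (\<Union>z\<in>V. (#) z ` {xs \<in> tuples V n. P (z # xs)})" by blast
  qed (auto simp: in_tuples_iff)
  have fin: "finite {xs \<in> tuples V n. P (z # xs)}" for z
    using finite_tuples[OF assms] by simp
  have "card {xs \<in> tuples V (Suc n). P xs} = (\<Sum>z\<in>V. card ((#) z ` {xs \<in> tuples V n. P (z # xs)}))"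
    unfolding eq by (rule card_UN_disjoint) (use assms fin in auto)
  also have "\<dots> = (\<Sum>z\<in>V. card {xs \<in> tuples V n. P (z # xs)})"
    by (intro sum.cong refl card_image) simp
  finally show ?thesis .
qed

text \<open>Markov's inequality in the form that an average of at least \<open>\<alpha> M\<close> of values at most \<open>M\<close>
  forces many values of size \<open>\<alpha> M / 2\<close>.\<close>

lemma markov_many_large:
  fixes f :: "'i \<Rightarrow> real"
  assumes A: "finite A" and M: "0 < M" and f: "\<And>x. x \<in> A \<Longrightarrow> f x \<le> M" and \<alpha>: "0 \<le> \<alpha>"
    and sum: "\<alpha> * M * card A \<le> (\<Sum>x\<in>A. f x)"
  shows "\<alpha> / 2 * card A \<le> card {x\<in>A. \<alpha> / 2 * M \<le> f x}"
proof -
  let ?B = "{x\<in>A. \<alpha> / 2 * M \<le> f x}"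
  have "(\<Sum>x\<in>A. f x) = (\<Sum>x\<in>?B. f x) + (\<Sum>x\<in>A - ?B. f x)"
    using sum.subset_diff[of ?B A f] A by (simp add: add.commute)
  also have "\<dots> \<le> card ?B * M + card (A - ?B) * (\<alpha> / 2 * M)"
    by (intro add_mono sum_bounded_above) (use f in auto)
  also have "\<dots> \<le> card ?B * M + card A * (\<alpha> / 2 * M)"
    by (intro add_left_mono mult_right_mono) (use A M \<alpha> in \<open>auto intro: card_mono\<close>)
  finally have "\<alpha> / 2 * card A * M \<le> card ?B * M" using sum by (simp add: algebra_simps)
  then show ?thesis using M by simp
qed

lemma sum_card_swap:
  assumes "finite A" "finite B"
  shows "(\<Sum>x\<in>A. card {y\<in>B. R x y}) = (\<Sum>y\<in>B. card {x\<in>A. R x y})"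
  by (rule sum_multicount_gen) (simp_all add: assms)

text \<open>The entries of \<open>As\<close> are the parts of a complete multipartite hypergraph with edges in \<open>E\<close>.\<close>

definition grid_in :: "('i list \<Rightarrow> bool) \<Rightarrow> 'i list list \<Rightarrow> bool" where
  "grid_in E As \<longleftrightarrow> (\<forall>ys. list_all2 (\<lambda>y A. y \<in> set A) ys As \<longrightarrow> E ys)"

lemma grid_in_Cons: "grid_in E (A # As) \<longleftrightarrow> grid_in (\<lambda>ys. \<forall>z\<in>set A. E (z # ys)) As"
  unfolding grid_in_def by (auto simp: list_all2_Cons2)

text \<open>The supersaturated form of the theorem of Erdos on complete multipartite subhypergraphs, by induction on
  the number of parts. On average, a \<open>q\<close>-tuple has many extensions by one more
  entry, hence many extensions by \<open>N\<close> entries at once. Counted the other way, many \<open>N\<close>-tuples \<open>A\<close> have a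
  dense set of common \<open>q\<close>-tuples, to which the induction hypothesis applies.\<close>

lemma many_grids:
  assumes \<alpha>: "0 < \<alpha>"
  shows "\<exists>\<gamma>>0. \<forall>(V :: 'i set) E. finite V \<longrightarrow> V \<noteq> {} \<longrightarrow>
    \<alpha> * real (card V ^ q) \<le> card {ys \<in> tuples V q. E ys} \<longrightarrow>
    \<gamma> * real ((card V ^ N) ^ q) \<le> card {As \<in> tuples (tuples V N) q. grid_in E As}"
  using \<alpha>
proof (induction q arbitrary: \<alpha>)
  case 0
  have "real 1 \<le> card {As \<in> tuples (tuples V N) 0. grid_in E As}"
    if "\<alpha> * real (card V ^ 0) \<le> card {ys \<in> tuples V 0. E ys}" for V :: "'i set" and E
  proof -
    have "0 < card {ys \<in> tuples V 0. E ys}" using that 0 by (auto simp: neq0_conv[symmetric] simp del: neq0_conv)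
    then have "{ys \<in> tuples V 0. E ys} \<noteq> {}" by (metis card.empty less_irrefl)
    then have "{As \<in> tuples (tuples V N) 0. grid_in E As} = {[]}" by (auto simp: grid_in_def in_tuples_iff)
    then show ?thesis by simp
  qed
  then show ?case by (intro exI[of _ 1]) simp
next
  case (Suc q)
  \<comment> \<open>a fraction \<open>\<alpha> / 2\<close> of the \<open>q\<close>-tuples has a fraction \<open>\<alpha> / 2\<close> of good extensions, hence \<open>(\<alpha> / 2) ^ N\<close> of good \<open>N\<close>-tuples of extensions\<close>
  define \<alpha>1 where "\<alpha>1 = (\<alpha> / 2) ^ Suc N"
  have "0 < \<alpha>1 / 2" using Suc.prems by (simp add: \<alpha>1_def)
  from Suc.IH[OF this] obtain \<gamma> where \<gamma>: "\<gamma> > 0" and IH: "\<And>(V :: 'i set) E. finite V \<Longrightarrow> V \<noteq> {} \<Longrightarrow>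
    \<alpha>1 / 2 * real (card V ^ q) \<le> card {ys \<in> tuples V q. E ys} \<Longrightarrow>
    \<gamma> * real ((card V ^ N) ^ q) \<le> card {As \<in> tuples (tuples V N) q. grid_in E As}" by blast
  have "\<alpha>1 / 2 * \<gamma> * real ((card V ^ N) ^ Suc q) \<le> card {As \<in> tuples (tuples V N) (Suc q). grid_in E As}"
    if V: "finite V" "V \<noteq> {}"
      and E: "\<alpha> * real (card V ^ Suc q) \<le> card {ys \<in> tuples V (Suc q). E ys}"
    for V :: "'i set" and E
  proof -
    define n where "n = real (card V)"
    have n: "n > 0" using V by (simp add: n_def card_gt_0_iff)
    have fin: "finite (tuples V k)" for k using V by (rule_tac finite_tuples)
    have card_tuples': "real (card (tuples V k)) = n ^ k" for k
      using V by (simp add: n_def card_tuples)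
    define d where "d ys = card {z\<in>V. E (z # ys)}" for ys
    define G where "G A ys \<longleftrightarrow> (\<forall>z\<in>set A. E (z # ys))" for A ys
    have "\<alpha> * n * n ^ q \<le> (\<Sum>ys\<in>tuples V q. real (d ys))"
    proof -
      have "card {ys \<in> tuples V (Suc q). E ys} = (\<Sum>ys\<in>tuples V q. d ys)"
        unfolding card_tuples_Suc[OF V(1)] d_def by (rule sum_card_swap[OF V(1) fin])
      then show ?thesis using E by (simp add: n_def mult.assoc)
    qed
    then have "\<alpha> / 2 * n ^ q \<le> card {ys\<in>tuples V q. \<alpha> / 2 * n \<le> d ys}"
      using markov_many_large[of "tuples V q" n "\<lambda>ys. real (d ys)" \<alpha>] fin n Suc.prems card_mono[OF V(1)]
      by (simp add: card_tuples' d_def n_def)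
    then have "\<alpha> / 2 * n ^ q * (\<alpha> / 2 * n) ^ N \<le>
        card {ys\<in>tuples V q. \<alpha> / 2 * n \<le> d ys} * (\<alpha> / 2 * n) ^ N"
      using n Suc.prems by (intro mult_right_mono) auto
    also have "\<dots> = (\<Sum>ys\<in>{ys\<in>tuples V q. \<alpha> / 2 * n \<le> d ys}. (\<alpha> / 2 * n) ^ N)" by simp
    also have "\<dots> \<le> (\<Sum>ys\<in>{ys\<in>tuples V q. \<alpha> / 2 * n \<le> d ys}. real (d ys) ^ N)"
      using n Suc.prems by (intro sum_mono power_mono) auto
    also have "\<dots> \<le> (\<Sum>ys\<in>tuples V q. real (d ys) ^ N)"
      using fin by (intro sum_mono2) auto
    also have "\<dots> = (\<Sum>ys\<in>tuples V q. card {A\<in>tuples V N. G A ys})"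
    proof -
      have "{A\<in>tuples V N. G A ys} = tuples {z\<in>V. E (z # ys)} N" for ys by (auto simp: G_def in_tuples_iff)
      then have "card {A\<in>tuples V N. G A ys} = d ys ^ N" for ys
        using V by (simp add: d_def card_tuples)
      then show ?thesis by simp
    qed
    also have "\<dots> = (\<Sum>A\<in>tuples V N. real (card {ys\<in>tuples V q. G A ys}))"
    proof -
      have "(\<Sum>ys\<in>tuples V q. card {A\<in>tuples V N. G A ys}) =
          (\<Sum>A\<in>tuples V N. card {ys\<in>tuples V q. G A ys})" by (rule sum_card_swap[OF fin fin])
      then show ?thesis by (simp flip: of_nat_sum)
    qed
    finally have "\<alpha> / 2 * n ^ q * (\<alpha> / 2 * n) ^ N \<le>
        (\<Sum>A\<in>tuples V N. real (card {ys\<in>tuples V q. G A ys}))" .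
    moreover have "\<alpha>1 * n ^ q * n ^ N = \<alpha> / 2 * n ^ q * (\<alpha> / 2 * n) ^ N"
      unfolding \<alpha>1_def power_Suc power_mult_distrib by (simp only: mult_ac)
    ultimately have avg: "\<alpha>1 * n ^ q * n ^ N \<le> (\<Sum>A\<in>tuples V N. real (card {ys\<in>tuples V q. G A ys}))"
      by (simp only:)
    have card_le: "real (card {ys\<in>tuples V q. G A ys}) \<le> n ^ q" for A
      using card_mono[OF fin[of q], of "{ys\<in>tuples V q. G A ys}"] by (simp flip: card_tuples')
    have large: "\<alpha>1 / 2 * n ^ N \<le>
        card {A\<in>tuples V N. \<alpha>1 / 2 * n ^ q \<le> card {ys\<in>tuples V q. G A ys}}"
      using markov_many_large[of "tuples V N" "n ^ q" "\<lambda>A. real (card {ys\<in>tuples V q. G A ys})" \<alpha>1]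
        fin n Suc.prems card_le avg by (simp add: card_tuples' \<alpha>1_def)
    let ?L = "{A\<in>tuples V N. \<alpha>1 / 2 * n ^ q \<le> card {ys\<in>tuples V q. G A ys}}"
    have "\<alpha>1 / 2 * \<gamma> * real ((card V ^ N) ^ Suc q) = \<alpha>1 / 2 * n ^ N * (\<gamma> * (n ^ N) ^ q)"
      by (simp add: n_def mult_ac)
    also have "\<dots> \<le> card ?L * (\<gamma> * (n ^ N) ^ q)"
      using large \<gamma> n by (intro mult_right_mono) auto
    also have "\<dots> = (\<Sum>A\<in>?L. \<gamma> * (n ^ N) ^ q)" by simp
    also have "\<dots> \<le> (\<Sum>A\<in>?L. real (card {As \<in> tuples (tuples V N) q. grid_in (G A) As}))"
    proof (intro sum_mono)
      fix A assume "A \<in> ?L"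
      then show "\<gamma> * (n ^ N) ^ q \<le> card {As \<in> tuples (tuples V N) q. grid_in (G A) As}"
        using IH[OF V, of "G A"] by (simp add: n_def)
    qed
    also have "\<dots> \<le> (\<Sum>A\<in>tuples V N. real (card {As \<in> tuples (tuples V N) q. grid_in (G A) As}))"
      using fin by (intro sum_mono2) auto
    also have "\<dots> = card {As \<in> tuples (tuples V N) (Suc q). grid_in E As}"
      unfolding card_tuples_Suc[OF fin] grid_in_Cons G_def by simp
    finally show ?thesis .
  qed
  then show ?case using \<gamma> Suc.prems by (intro exI[of _ "\<alpha>1 / 2 * \<gamma>"]) (simp add: \<alpha>1_def)
qed

lemma card_tuples_hitting:
  assumes "finite X"
  shows "card {xs \<in> tuples X q. \<exists>x\<in>set xs. x \<in> B} * card X \<le> q * card (X \<inter> B) * card X ^ q"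
proof (induction q)
  case 0
  then show ?case by (simp add: in_tuples_iff)
next
  case (Suc q)
  let ?H = "{xs \<in> tuples X q. \<exists>x\<in>set xs. x \<in> B}"
  have "card {xs \<in> tuples X (Suc q). \<exists>x\<in>set xs. x \<in> B} =
      (\<Sum>z\<in>X. card {xs \<in> tuples X q. z \<in> B \<or> (\<exists>x\<in>set xs. x \<in> B)})"
    by (simp add: card_tuples_Suc[OF assms] bex_disj_distrib)
  also have "\<dots> \<le> (\<Sum>z\<in>X. (if z \<in> B then card X ^ q else 0) + card ?H)"
  proof (intro sum_mono)
    fix z
    have "card {xs \<in> tuples X q. z \<in> B \<or> (\<exists>x\<in>set xs. x \<in> B)} \<le> card (tuples X q)" if "z \<in> B"
      using finite_tuples[OF assms] by (intro card_mono) auto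
    then show "card {xs \<in> tuples X q. z \<in> B \<or> (\<exists>x\<in>set xs. x \<in> B)} \<le>
        (if z \<in> B then card X ^ q else 0) + card ?H"
      using card_tuples[OF assms, of q] by (auto simp: trans_le_add1)
  qed
  also have "\<dots> = card (X \<inter> B) * card X ^ q + card X * card ?H"
    using assms by (simp add: sum.distrib sum.inter_restrict[symmetric])
  finally have "card {xs \<in> tuples X (Suc q). \<exists>x\<in>set xs. x \<in> B} * card X \<le>
      (card (X \<inter> B) * card X ^ q + card X * card ?H) * card X" by (rule mult_right_mono) simp
  also have "\<dots> \<le> card (X \<inter> B) * card X ^ Suc q + card X * (q * card (X \<inter> B) * card X ^ q)"
    using mult_left_mono[OF Suc.IH, of "card X"] by (simp add: algebra_simps)
  also have "\<dots> = Suc q * card (X \<inter> B) * card X ^ Suc q" by (simp add: algebra_simps)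
  finally show ?case .
qed

text \<open>If at most \<open>D\<close> values of the coordinate \<open>j\<close> are good whatever the other coordinates are, then
  the good tuples form at most the fraction \<open>D / card V\<close> of all tuples. The factor \<open>card V\<close> stands on the left to avoid a subtraction
  in the exponent.\<close>

lemma card_tuples_one_coordinate:
  assumes "finite V" "j < N" "\<And>A. A \<in> tuples V N \<Longrightarrow> card {z\<in>V. Q (A[j := z])} \<le> D"
  shows "card {A \<in> tuples V N. Q A} * card V \<le> card V ^ N * D"
  using assms(2,3)
proof (induction j arbitrary: N Q)
  case 0
  then obtain N' where N: "N = Suc N'" by (cases N) auto
  have "card {A \<in> tuples V N. Q A} = (\<Sum>ys\<in>tuples V N'. card {z\<in>V. Q (z # ys)})"
    unfolding N card_tuples_Suc[OF assms(1)]
    by (rule sum_card_swap) (use assms finite_tuples in auto)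
  also have "\<dots> * card V \<le> card (tuples V N') * D * card V"
  proof (cases "V = {}")
    case False
    then obtain v where "v \<in> V" by blast
    have "(\<Sum>ys\<in>tuples V N'. card {z\<in>V. Q (z # ys)}) \<le> (\<Sum>ys\<in>tuples V N'. D)"
    proof (rule sum_mono)
      fix ys assume "ys \<in> tuples V N'"
      then show "card {z\<in>V. Q (z # ys)} \<le> D"
        using 0(2)[of "v # ys"] \<open>v \<in> V\<close> by (simp add: N in_tuples_iff)
    qed
    then show ?thesis by simp
  qed simp
  finally show ?case by (simp add: N card_tuples[OF assms(1)] mult_ac)
next
  case (Suc j)
  then obtain N' where N: "N = Suc N'" by (cases N) auto
  have "card {A \<in> tuples V N. Q A} * card V = (\<Sum>z\<in>V. card {A \<in> tuples V N'. Q (z # A)} * card V)"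
    by (simp add: N card_tuples_Suc[OF assms(1)] sum_distrib_right)
  also have "\<dots> \<le> (\<Sum>z\<in>V. card V ^ N' * D)"
  proof (intro sum_mono Suc.IH)
    show "j < N'" using Suc.prems N by simp
    fix z A assume "z \<in> V" "A \<in> tuples V N'"
    then show "card {y \<in> V. Q (z # A[j := y])} \<le> D" 
      using Suc.prems(2)[of "z # A"] N by (simp add: in_tuples_iff)
  qed
  finally show ?case by (simp add: N mult.assoc)
qed

section \<open>Fractional Helly theorem relative to a finite ground set\<close>

lemma finite_has_largest:
  fixes f :: "'b \<Rightarrow> nat"
  assumes "finite P" "P \<noteq> {}"
  obtains p where "p \<in> P" "\<forall>s\<in>P. f s \<le> f p"
proof -
  have "Max (f ` P) \<in> f ` P" using assms by (intro Max_in) auto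
  then obtain p where "p \<in> P" "f p = Max (f ` P)" by auto
  then show ?thesis using that assms by (metis Max_ge finite_imageI imageI)
qed

text \<open>For a tuple in \<open>B\<close>, the last common point of its \<open>h\<close> sets is already the last common point of fewer than
  \<open>h\<close> of them, say those at the positions \<open>J'\<close>, and it lies in the set at another position \<open>j\<close>. Once \<open>j\<close>, \<open>J'\<close> and all
  entries except for the one at \<open>j\<close> are fixed, this point is fixed, and only \<open>D\<close> entries contain it.\<close>

lemma rich_tuples_give_deep_point:
  fixes T :: "'a::euclidean_space set" and C :: "'i \<Rightarrow> 'a set"
  assumes T: "finite T" "segment_rich h T" and V: "finite V" "\<And>i. i \<in> V \<Longrightarrow> convex (C i)"
    and B: "B = {A \<in> tuples V N. \<exists>J\<subseteq>{..<N}. card J = h \<and> (\<exists>x\<in>T. \<forall>k\<in>J. x \<in> C (A ! k))}"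
    and D: "\<And>p. p \<in> T \<Longrightarrow> card {i\<in>V. p \<in> C i} \<le> D"
  shows "card B * card V \<le> N * 2 ^ N * (card V ^ N * D)"
proof -
  obtain \<rho> :: "'a \<Rightarrow> nat" where inj: "inj_on \<rho> T"
    and \<rho>: "\<forall>p\<in>T. p \<notin> convex hull {s\<in>T. \<rho> s > \<rho> p}" using peeling_order_exists[OF T(1)] by blast
  define last_in where "last_in A J p \<longleftrightarrow>
      p \<in> T \<and> (\<forall>k\<in>J. p \<in> C (A ! k)) \<and> (\<forall>s\<in>T. (\<forall>k\<in>J. s \<in> C (A ! k)) \<longrightarrow> \<rho> s \<le> \<rho> p)" for A J p
  have last_unique: "p = q" if "last_in A J p" "last_in A J q" for A J p q
    using that inj by (metis (no_types, lifting) inj_onD last_in_def order_antisym)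
  \<comment> \<open>tuples whose entry at \<open>j\<close> contains the point that the entries at \<open>J\<close> determine\<close>
  define R where "R = (\<lambda>(j, J). {A \<in> tuples V N. j \<notin> J \<and> (\<exists>p. last_in A J p \<and> p \<in> C (A ! j))})"
  have finR: "finite (R w)" for w using finite_tuples[OF V(1)] by (auto simp: R_def split: prod.split)
  have "B \<subseteq> (\<Union>w\<in>{..<N} \<times> Pow {..<N}. R w)"
  proof
    fix A assume "A \<in> B"
    then obtain J where A: "A \<in> tuples V N" and J: "J \<subseteq> {..<N}" "card J = h"
      and "\<exists>x\<in>T. \<forall>k\<in>J. x \<in> C (A ! k)" by (auto simp: B)
    define P where "P = {x\<in>T. \<forall>k\<in>J. x \<in> C (A ! k)}"
    have "finite P" "P \<noteq> {}" using T(1) \<open>\<exists>x\<in>T. _ x\<close> by (auto simp: P_def)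
    then obtain p where p: "p \<in> P" "\<forall>s\<in>P. \<rho> s \<le> \<rho> p" by (rule finite_has_largest)
    have finJ: "finite J" using J(1) finite_subset by blast
    have "\<exists>J'\<subseteq>J. card J' < h \<and> (\<forall>s\<in>T. (\<forall>k\<in>J'. s \<in> C (A ! k)) \<longrightarrow> \<rho> s \<le> \<rho> p)"
    proof (rule last_point_determined[OF T finJ _ \<rho>])
      show "convex (C (A ! k))" if "k \<in> J" for k
        using A J(1) V(2) that by (auto simp: in_tuples_iff intro!: nth_mem)
    qed (use p in \<open>auto simp: P_def\<close>)
    then obtain J' where J': "J' \<subseteq> J" "card J' < h"
      and "\<forall>s\<in>T. (\<forall>k\<in>J'. s \<in> C (A ! k)) \<longrightarrow> \<rho> s \<le> \<rho> p" by blast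
    then have "last_in A J' p" using p by (auto simp: last_in_def P_def)
    moreover obtain j where "j \<in> J" "j \<notin> J'" using J' J(2) by (metis less_irrefl subsetI subset_antisym)
    ultimately have "A \<in> R (j, J')" using A p by (auto simp: R_def P_def)
    moreover have "(j, J') \<in> {..<N} \<times> Pow {..<N}" using J(1) J'(1) \<open>j \<in> J\<close> by blast
    ultimately show "A \<in> (\<Union>w\<in>{..<N} \<times> Pow {..<N}. R w)" by blast
  qed
  then have "card B \<le> card (\<Union>w\<in>{..<N} \<times> Pow {..<N}. R w)"
    by (rule card_mono[rotated]) (use finR in auto)
  also have "\<dots> \<le> (\<Sum>w\<in>{..<N} \<times> Pow {..<N}. card (R w))" by (rule card_UN_le) simp
  finally have "card B * card V \<le> (\<Sum>w\<in>{..<N} \<times> Pow {..<N}. card (R w) * card V)"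
    by (metis mult_le_mono1 sum_distrib_right)
  also have "\<dots> \<le> (\<Sum>w\<in>{..<N} \<times> Pow {..<N::nat}. card V ^ N * D)"
  proof (rule sum_mono)
    fix w assume "w \<in> {..<N} \<times> Pow {..<N}"
    then obtain j J where w: "w = (j, J)" "j < N" by auto
    have "card {A \<in> tuples V N. j \<notin> J \<and> (\<exists>p. last_in A J p \<and> p \<in> C (A ! j))} * card V \<le> card V ^ N * D"
    proof (rule card_tuples_one_coordinate[OF V(1) w(2)])
      fix A assume A: "A \<in> tuples V N"
      show "card {z\<in>V. j \<notin> J \<and> (\<exists>p. last_in (A[j := z]) J p \<and> p \<in> C (A[j := z] ! j))} \<le> D"
      proof (cases "j \<notin> J \<and> (\<exists>p. last_in A J p)")
        case True
        then obtain p where p: "last_in A J p" by blast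
        have "last_in (A[j := z]) J = last_in A J" for z
        proof -
          have "A[j := z] ! k = A ! k" if "k \<in> J" for k using True that by (metis nth_list_update_neq)
          then show ?thesis by (simp add: last_in_def fun_eq_iff)
        qed
        then have "{z\<in>V. j \<notin> J \<and> (\<exists>p. last_in (A[j := z]) J p \<and> p \<in> C (A[j := z] ! j))} \<subseteq> {z\<in>V. p \<in> C z}"
          using A w(2) last_unique[OF p] by (auto simp: in_tuples_iff)
        then have "card {z\<in>V. j \<notin> J \<and> (\<exists>p. last_in (A[j := z]) J p \<and> p \<in> C (A[j := z] ! j))} \<le> card {z\<in>V. p \<in> C z}"
          using V(1) by (intro card_mono) auto
        also have "\<dots> \<le> D" using D p by (simp add: last_in_def)
        finally show ?thesis .
      next
        case False
        have "last_in (A[j := z]) J = last_in A J" if "j \<notin> J" for z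
        proof -
          have "A[j := z] ! k = A ! k" if "k \<in> J" for k using \<open>j \<notin> J\<close> that by (metis nth_list_update_neq)
          then show ?thesis by (simp add: last_in_def fun_eq_iff)
        qed
        then have "{z\<in>V. j \<notin> J \<and> (\<exists>p. last_in (A[j := z]) J p \<and> p \<in> C (A[j := z] ! j))} = {}"
          using False by auto
        then show ?thesis by (simp only: card.empty)
      qed
    qed
    then show "card (R w) * card V \<le> card V ^ N * D" by (simp add: R_def w)
  qed
  also have "\<dots> = N * 2 ^ N * (card V ^ N * D)" by (simp add: card_Pow)
  finally show ?thesis .
qed

text \<open>Fractional Helly number \<open>m + 1\<close> for the traces of convex sets on \<open>T\<close>, with a constant that depends on \<open>T\<close> only through
  \<open>h\<close>. Density is measured among all tuples, with repetitions allowed, which turns every count into a power of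
  \<open>card V\<close>.\<close>

theorem fractional_helly_finite_ground_set:
  assumes \<alpha>: "0 < \<alpha>" and h: "0 < h"
  shows "\<exists>\<beta>>0. \<forall>(T :: 'a::euclidean_space set) (C :: 'i \<Rightarrow> 'a set) V.
    finite T \<longrightarrow> segment_rich h T \<longrightarrow> finite V \<longrightarrow> V \<noteq> {} \<longrightarrow> (\<forall>i\<in>V. convex (C i)) \<longrightarrow>
    \<alpha> * real (card V ^ Suc DIM('a)) \<le>
      card {ys \<in> tuples V (Suc DIM('a)). \<exists>x\<in>T. \<forall>i\<in>set ys. x \<in> C i} \<longrightarrow>
    (\<exists>p\<in>T. \<beta> * real (card V) \<le> card {i\<in>V. p \<in> C i})"
proof -
  define q where "q = Suc DIM('a)"
  from colour_class_meets[OF h, where 'a = 'a]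
  obtain N :: nat where N: "N > 0" and meets: "\<And>(T :: 'a set) C.
    finite T \<Longrightarrow> segment_rich h T \<Longrightarrow> \<forall>c\<le>DIM('a). \<forall>i<N. convex (C c i) \<Longrightarrow>
    \<forall>I\<in>{..DIM('a)} \<rightarrow>\<^sub>E {..<N}. \<exists>x\<in>T. \<forall>c\<le>DIM('a). x \<in> C c (I c) \<Longrightarrow>
    \<exists>c\<le>DIM('a). \<exists>J\<subseteq>{..<N}. card J = h \<and> (\<exists>x\<in>T. \<forall>k\<in>J. x \<in> C c k)" by blast
  from many_grids[OF \<alpha>, of q N, where 'i = 'i]
  obtain \<gamma> where \<gamma>: "\<gamma> > 0" and grids: "\<And>(V :: 'i set) E. finite V \<Longrightarrow> V \<noteq> {} \<Longrightarrow>
    \<alpha> * real (card V ^ q) \<le> card {ys \<in> tuples V q. E ys} \<Longrightarrow>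
    \<gamma> * real ((card V ^ N) ^ q) \<le> card {As \<in> tuples (tuples V N) q. grid_in E As}" by blast
  define K where "K = q * (N * 2 ^ N)"
  have K: "K > 0" using N by (simp add: K_def q_def)
  define \<beta> where "\<beta> = \<gamma> / real K"
  have "\<beta> > 0" using \<gamma> K by (simp add: \<beta>_def)
  moreover have "\<exists>p\<in>T. \<beta> * real (card V) \<le> card {i\<in>V. p \<in> C i}"
    if T: "finite T" "segment_rich h T" and V: "finite V" "V \<noteq> {}" and conv: "\<forall>i\<in>V. convex (C i)"
      and dense: "\<alpha> * real (card V ^ q) \<le> card {ys \<in> tuples V q. \<exists>x\<in>T. \<forall>i\<in>set ys. x \<in> C i}"
    for T :: "'a set" and C :: "'i \<Rightarrow> 'a set" and V
  proof -
    define n where "n = card V"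
    have n: "n > 0" using V by (simp add: n_def card_gt_0_iff)
    define B where "B = {A \<in> tuples V N. \<exists>J\<subseteq>{..<N}. card J = h \<and> (\<exists>x\<in>T. \<forall>k\<in>J. x \<in> C (A ! k))}"
    let ?E = "\<lambda>ys. \<exists>x\<in>T. \<forall>i\<in>set ys. x \<in> C i"
    have hit: "\<exists>A\<in>set As. A \<in> B" if As: "As \<in> tuples (tuples V N) q" "grid_in ?E As" for As
    proof -
      have len: "length As = q" "\<And>c. c \<le> DIM('a) \<Longrightarrow> As ! c \<in> tuples V N"
        using As(1) by (auto simp: in_tuples_iff[of As] q_def)
      have "\<exists>c\<le>DIM('a). \<exists>J\<subseteq>{..<N}. card J = h \<and> (\<exists>x\<in>T. \<forall>k\<in>J. x \<in> C (As ! c ! k))"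
      proof (rule meets[OF T])
        show "\<forall>c\<le>DIM('a). \<forall>i<N. convex (C (As ! c ! i))"
          using len(2) conv by (auto simp: in_tuples_iff intro!: bspec[OF conv] subsetD[OF _ nth_mem])
        show "\<forall>I\<in>{..DIM('a)} \<rightarrow>\<^sub>E {..<N}. \<exists>x\<in>T. \<forall>c\<le>DIM('a). x \<in> C (As ! c ! I c)"
        proof
          fix I assume I: "I \<in> {..DIM('a)} \<rightarrow>\<^sub>E {..<N}"
          define ys where "ys = map (\<lambda>c. As ! c ! I c) [0..<q]"
          have "list_all2 (\<lambda>y A. y \<in> set A) ys As"
          proof (rule list_all2_all_nthI)
            show "length ys = length As" by (simp add: ys_def len)
            fix c assume "c < length ys"
            then have c: "c \<le> DIM('a)" "ys ! c = As ! c ! I c" by (auto simp: ys_def q_def simp del: upt_Suc)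
            have "I c < N" using I c by auto
            then show "ys ! c \<in> set (As ! c)" using len(2)[OF c(1)] c(2) by (simp add: in_tuples_iff)
          qed
          then have "?E ys" using As(2) by (simp add: grid_in_def)
          moreover have "As ! c ! I c \<in> set ys" if "c \<le> DIM('a)" for c
            using that by (auto simp: ys_def q_def simp del: upt_Suc)
          ultimately show "\<exists>x\<in>T. \<forall>c\<le>DIM('a). x \<in> C (As ! c ! I c)" by blast
        qed
      qed
      then obtain c where "c \<le> DIM('a)" "As ! c \<in> B" using len(2) by (auto simp: B_def)
      then show ?thesis using len(1) by (intro bexI[of _ "As ! c"]) (auto simp: q_def)
    qed
    have finX: "finite (tuples V N)" using V finite_tuples by blast
    have cardX: "card (tuples V N) = n ^ N" using V card_tuples by (simp add: n_def)
    have "\<gamma> * real ((n ^ N) ^ q) \<le> card {As \<in> tuples (tuples V N) q. grid_in ?E As}"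
      using grids[OF V dense] by (simp add: n_def)
    also have "\<dots> \<le> card {As \<in> tuples (tuples V N) q. \<exists>A\<in>set As. A \<in> B}"
      using hit finite_tuples[OF finX] by (intro of_nat_mono card_mono) auto
    finally have "\<gamma> * real ((n ^ N) ^ q) * real (n ^ N) \<le>
        real (card {As \<in> tuples (tuples V N) q. \<exists>A\<in>set As. A \<in> B}) * real (n ^ N)"
      by (rule mult_right_mono) simp
    also have "\<dots> = real (card {As \<in> tuples (tuples V N) q. \<exists>A\<in>set As. A \<in> B} * card (tuples V N))"
      by (simp add: cardX)
    also have "\<dots> \<le> real (q * card (tuples V N \<inter> B) * card (tuples V N) ^ q)"
      by (intro of_nat_mono card_tuples_hitting finX)
    also have "tuples V N \<inter> B = B" by (auto simp: B_def)
    finally have "\<gamma> * real (n ^ N) * real ((n ^ N) ^ q) \<le> q * card B * real ((n ^ N) ^ q)"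
      by (simp add: cardX mult_ac)
    then have "\<gamma> * real (n ^ N) \<le> q * card B" using n by simp
    then have "\<gamma> * real (n ^ N) * n \<le> real (q * card B) * real n" by (rule mult_right_mono) simp
    also have "\<dots> = real (q * (card B * n))" by simp
    finally have B_large: "\<gamma> * real (n ^ N) * n \<le> real (q * (card B * n))" .
    have "T \<noteq> {}"
    proof
      assume "T = {}"
      then have "\<alpha> * real (card V ^ q) \<le> 0" using dense by simp
      moreover have "0 < \<alpha> * real (card V ^ q)" using \<alpha> n by (intro mult_pos_pos) (auto simp: n_def)
      ultimately show False by linarith
    qed
    with T(1) obtain p where p: "p \<in> T" "\<forall>p'\<in>T. card {i\<in>V. p' \<in> C i} \<le> card {i\<in>V. p \<in> C i}"
      by (rule finite_has_largest)
    define D where "D = card {i\<in>V. p \<in> C i}"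
    have "card B * n \<le> N * 2 ^ N * (n ^ N * D)"
      unfolding n_def by (rule rich_tuples_give_deep_point[OF T V(1) _ B_def])
        (use conv p in \<open>auto simp: D_def\<close>)
    then have "real (q * (card B * n)) \<le> real (q * (N * 2 ^ N * (n ^ N * D)))"
      by (intro of_nat_mono mult_left_mono) auto
    also have "q * (N * 2 ^ N * (n ^ N * D)) = K * D * n ^ N" by (simp add: K_def mult_ac)
    finally have "\<gamma> * n * real (n ^ N) \<le> real K * D * real (n ^ N)"
      using B_large by (simp add: mult_ac)
    then have "\<gamma> * n \<le> real K * D" using n by simp
    then have "\<beta> * n \<le> D" using K by (simp add: \<beta>_def field_simps)
    then show ?thesis using p(1) by (auto simp: D_def n_def)
  qed
  ultimately show ?thesis unfolding q_def by (intro exI[of _ \<beta>]) blast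
qed

section \<open>Arithmetic progressions of integer points as points of a product space\<close>

lemma finite_integer_points_bounded:
  fixes S :: "(real ^ 'n) set"
  assumes "bounded S"
  shows "finite (S \<inter> integer_points)"
proof -
  obtain B where B: "\<And>x. x \<in> S \<Longrightarrow> norm x \<le> B" using assms by (auto simp: bounded_iff)
  define f where "f x = (\<lambda>i. \<lfloor>x $ i\<rfloor>)" for x :: "real ^ 'n"
  have "f x \<in> UNIV \<rightarrow>\<^sub>E {-\<lceil>B\<rceil>..\<lceil>B\<rceil>}" if "x \<in> S \<inter> integer_points" for x
  proof -
    have "\<bar>x $ i\<bar> \<le> B" for i using B[of x] that component_le_norm_cart[of x i] by auto
    then have "x $ i \<le> B" "- B \<le> x $ i" for i by (simp_all add: abs_le_iff minus_le_iff)
    then have hi: "x $ i \<le> of_int \<lceil>B\<rceil>" and lo: "- of_int \<lceil>B\<rceil> \<le> x $ i" for i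
      using le_of_int_ceiling[of B] by (meson order_trans neg_le_iff_le)+
    have "\<lfloor>x $ i\<rfloor> \<le> \<lceil>B\<rceil>" "- \<lceil>B\<rceil> \<le> \<lfloor>x $ i\<rfloor>" for i
      using floor_mono[OF hi[of i]] lo[of i] by (simp_all add: le_floor_iff)
    then show ?thesis by (auto simp: f_def PiE_iff extensional_def)
  qed
  then have "f ` (S \<inter> integer_points) \<subseteq> UNIV \<rightarrow>\<^sub>E {-\<lceil>B\<rceil>..\<lceil>B\<rceil>}" by blast
  then have "finite (f ` (S \<inter> integer_points))"
    by (rule finite_subset) (simp add: finite_PiE)
  moreover have "inj_on f (S \<inter> integer_points)"
  proof (rule inj_onI)
    fix x y assume xy: "x \<in> S \<inter> integer_points" "y \<in> S \<inter> integer_points" "f x = f y"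
    then have "\<lfloor>x $ i\<rfloor> = \<lfloor>y $ i\<rfloor>" for i by (auto simp: f_def fun_eq_iff)
    moreover have "x $ i \<in> \<int>" "y $ i \<in> \<int>" for i using xy by (auto simp: integer_points_def)
    ultimately show "x = y" by (simp add: vec_eq_iff) (metis floor_of_int Ints_cases)
  qed
  ultimately show ?thesis by (rule finite_imageD)
qed

text \<open>A pair \<open>(x, v)\<close> stands for the arithmetic progression \<open>x, x + v, x + 2 v, \<dots>\<close> of integer points.\<close>

definition progressions :: "((real ^ 'n) \<times> (real ^ 'n)) set" where
  "progressions = {(x, v). x \<in> integer_points \<and> v \<in> integer_points \<and> v \<noteq> 0}"

definition residue :: "real ^ 'n \<Rightarrow> 'n \<Rightarrow> int" where
  "residue x = (\<lambda>i. \<lfloor>x $ i\<rfloor> mod 3)"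

text \<open>Points that agree modulo 3 differ by three times an integer vector.\<close>

lemma third_points_integer:
  assumes x: "x \<in> integer_points" and y: "y \<in> integer_points" and res: "residue x = residue y"
  shows "x + (of_int j / 3) *\<^sub>R (y - x) \<in> integer_points"
proof -
  have "(x + (of_int j / 3) *\<^sub>R (y - x)) $ i \<in> \<int>" for i
  proof -
    obtain a b where ab: "x $ i = of_int a" "y $ i = of_int b"
      using x y unfolding integer_points_def by (blast elim: Ints_cases)
    have "a mod 3 = b mod 3" using fun_cong[OF res, of i] by (simp add: residue_def ab)
    then obtain c where "b - a = 3 * c" by (metis mod_eq_dvd_iff dvdE)
    then have "b = a + 3 * c" by simp
    then have "(x + (of_int j / 3) *\<^sub>R (y - x)) $ i = of_int (a + j * c)" by (simp add: ab)
    then show ?thesis by simp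
  qed
  then show ?thesis by (simp add: integer_points_def)
qed

definition residue_pairs :: "(('n::finite \<Rightarrow> int) \<times> ('n \<Rightarrow> int)) set" where
  "residue_pairs = (UNIV \<rightarrow>\<^sub>E {0..2}) \<times> (UNIV \<rightarrow>\<^sub>E {0..2})"

lemma finite_residue_pairs: "finite residue_pairs"
  by (simp add: residue_pairs_def finite_PiE)

text \<open>Halving a segment would not do: the midpoint of two pairs can have second component 0, as for
  \<open>v\<close> and \<open>-v\<close>. Of the two third points of a segment at most one has this defect.\<close>

lemma progressions_segment_rich:
  fixes K :: "((real ^ 'n) \<times> (real ^ 'n)) set"
  assumes K: "convex K"
  shows "segment_rich (card (residue_pairs :: (('n \<Rightarrow> int) \<times> ('n \<Rightarrow> int)) set)) (progressions \<inter> K)"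
  unfolding segment_rich_def
proof (intro allI impI)
  fix X :: "((real ^ 'n) \<times> (real ^ 'n)) set"
  assume X: "X \<subseteq> progressions \<inter> K"
    and large: "card X > card (residue_pairs :: (('n \<Rightarrow> int) \<times> ('n \<Rightarrow> int)) set)"
  define f where "f = (\<lambda>p :: (real ^ 'n) \<times> (real ^ 'n). (residue (fst p), residue (snd p)))"
  have "f ` X \<subseteq> residue_pairs" by (auto simp: f_def residue_pairs_def residue_def)
  then have "card (f ` X) < card X"
    using large card_mono[OF finite_residue_pairs, of "f ` X"] by linarith
  then have "\<not> inj_on f X" using card_image by fastforce
  then obtain p q where pq: "p \<in> X" "q \<in> X" "p \<noteq> q" "f p = f q" by (auto simp: inj_on_def)
  define s where "s j = p + (of_int j / 3) *\<^sub>R (q - p)" for j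
  have res: "residue (fst p) = residue (fst q)" "residue (snd p) = residue (snd q)"
    using pq(4) by (auto simp: f_def)
  have int: "fst p \<in> integer_points" "fst q \<in> integer_points" "snd p \<in> integer_points" "snd q \<in> integer_points"
    "snd p \<noteq> 0" and K': "p \<in> K" "q \<in> K"
    using pq(1,2) X by (auto simp: progressions_def)
  have s_int: "fst (s j) \<in> integer_points" "snd (s j) \<in> integer_points" for j
    using third_points_integer[OF int(1,2) res(1)] third_points_integer[OF int(3,4) res(2)]
    by (simp_all add: s_def)
  have s_seg: "s j \<in> open_segment p q" if "j = 1 \<or> j = 2" for j
    using that pq(3) unfolding in_segment
    by (intro conjI exI[of _ "of_int j / 3"]) (auto simp: s_def algebra_simps)
  have "open_segment p q \<subseteq> K" using K K' convex_contains_open_segment by blast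
  then have sK: "s j \<in> K" if "j = 1 \<or> j = 2" for j using s_seg that by blast
  have "snd (s 1) \<noteq> 0 \<or> snd (s 2) \<noteq> 0"
  proof (rule ccontr)
    assume "\<not> ?thesis"
    then have "snd (2 *\<^sub>R s 1 - s 2) = 0" by simp
    moreover have "2 *\<^sub>R s 1 - s 2 = p"
      using scaleR_2[of p] by (simp add: s_def scaleR_add_right)
    ultimately show False using int(5) by simp
  qed
  then obtain j where "j = 1 \<or> j = 2" "snd (s j) \<noteq> 0" by blast
  then have "s j \<in> (progressions \<inter> K) \<inter> open_segment p q"
    using s_int[of j] sK[of j] s_seg[of j] by (cases "s j") (auto simp: progressions_def)
  then show "\<exists>x\<in>X. \<exists>y\<in>X. x \<noteq> y \<and> (progressions \<inter> K) \<inter> open_segment x y \<noteq> {}"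
    using pq by blast
qed

lemma finite_progressions_bounded:
  fixes K :: "((real ^ 'n) \<times> (real ^ 'n)) set"
  assumes "bounded K"
  shows "finite (progressions \<inter> K)"
proof -
  have "progressions \<inter> K \<subseteq> (fst ` K \<inter> integer_points) \<times> (snd ` K \<inter> integer_points)"
    by (force simp: progressions_def)
  then show ?thesis
    using assms by (rule_tac finite_subset) (auto intro!: finite_integer_points_bounded bounded_fst bounded_snd)
qed

section \<open>Colinear integer points and progressions\<close>

lemma convex_contains_translate:
  fixes w :: "'a::real_vector"
  assumes S: "convex S" "x \<in> S" "x + M *\<^sub>R w \<in> S" and t: "0 \<le> t" "t \<le> M"
  shows "x + t *\<^sub>R w \<in> S"
proof (cases "M = 0")
  case True
  then show ?thesis using S t by simp
next
  case False
  then have "x + t *\<^sub>R w = (1 - t / M) *\<^sub>R x + (t / M) *\<^sub>R (x + M *\<^sub>R w)"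
    by (simp add: algebra_simps)
  moreover have "(1 - t / M) *\<^sub>R x + (t / M) *\<^sub>R (x + M *\<^sub>R w) \<in> S"
    using S(2,3) t False by (intro convexD[OF S(1)]) (auto simp: divide_simps)
  ultimately show ?thesis by simp
qed

lemma integer_points_scaled_add:
  assumes "x \<in> integer_points" "y \<in> integer_points"
  shows "x + of_int j *\<^sub>R y \<in> integer_points"
  using assms by (auto simp: integer_points_def)

lemma integer_points_diff:
  assumes "x \<in> integer_points" "y \<in> integer_points"
  shows "x - y \<in> integer_points"
  using assms by (auto simp: integer_points_def)

lemma colinear_from_progression:
  fixes S :: "(real ^ 'n) set"
  assumes S: "convex S" "(x, v) \<in> progressions" "x \<in> S" "x + real (k - 1) *\<^sub>R v \<in> S"
  shows "contains_colinear_integer_points k S"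
proof -
  define P where "P = (\<lambda>j. x + real j *\<^sub>R v) ` {..<k}"
  have xv: "x \<in> integer_points" "v \<in> integer_points" "v \<noteq> 0" using S(2) by (auto simp: progressions_def)
  have "P \<subseteq> S" 
    using convex_contains_translate[OF S(1,3,4)] by (auto simp: P_def)
  moreover have "P \<subseteq> integer_points"
    using integer_points_scaled_add[OF xv(1,2), of "int _"] by (auto simp: P_def)
  moreover have "card P = k" unfolding P_def using xv(3) by (subst card_image) (auto simp: inj_on_def)
  moreover have "collinear P"
  proof -
    have "\<exists>c. a - b = c *\<^sub>R v" if ab: "a \<in> P" "b \<in> P" for a b
    proof -
      obtain i j where "a = x + real i *\<^sub>R v" "b = x + real j *\<^sub>R v" using ab by (auto simp: P_def)
      then have "a - b = (real i - real j) *\<^sub>R v" by (simp add: scaleR_diff_left)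
      then show ?thesis by blast
    qed
    then show ?thesis unfolding collinear_def by blast
  qed
  ultimately show ?thesis unfolding contains_colinear_integer_points_def P_def by blast
qed

text \<open>Among the integer vectors on the line choose \<open>w\<close> with the least positive coordinate \<open>i\<close>, where \<open>d\<close> does
  not vanish at \<open>i\<close>. Division with remainder by this coordinate shows that \<open>w\<close> generates all the others.\<close>

lemma integer_points_on_line_generated:
  fixes d :: "real ^ 'n"
  assumes d: "d \<in> integer_points" "d \<noteq> 0"
  obtains w where "w \<in> integer_points" "w \<noteq> 0"
    "\<And>c. c *\<^sub>R d \<in> integer_points \<Longrightarrow> \<exists>m::int. c *\<^sub>R d = of_int m *\<^sub>R w"
proof -
  obtain i where i: "d $ i \<noteq> 0" using d(2) by (auto simp: vec_eq_iff)
  define attained where "attained n \<longleftrightarrow> n > 0 \<and> (\<exists>c. c *\<^sub>R d \<in> integer_points \<and> c * d $ i = real n)" for n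
  have "attained (nat \<bar>\<lfloor>d $ i\<rfloor>\<bar>)"
  proof -
    obtain a where a: "d $ i = of_int a" using d(1) by (auto simp: integer_points_def elim: Ints_cases)
    have "- d \<in> integer_points" using d(1) by (auto simp: integer_points_def)
    then show ?thesis using i d(1) unfolding attained_def a
      by (intro conjI exI[of _ "of_int (sgn a)"]) (auto simp: sgn_if)
  qed
  then obtain g where g: "attained g" "\<And>n. attained n \<Longrightarrow> g \<le> n" by (metis LeastI Least_le)
  then obtain c0 where c0: "c0 *\<^sub>R d \<in> integer_points" "c0 * d $ i = real g" and "g > 0"
    by (auto simp: attained_def)
  show thesis
  proof (rule that[of "c0 *\<^sub>R d"])
    show "c0 *\<^sub>R d \<noteq> 0" using c0 \<open>g > 0\<close> d by auto
    fix c assume c: "c *\<^sub>R d \<in> integer_points"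
    then have "(c *\<^sub>R d) $ i \<in> \<int>" unfolding integer_points_def by blast
    then obtain m where m: "c * d $ i = of_int m" by (auto elim: Ints_cases)
    define r where "r = c - of_int (m div int g) * c0"
    have r_int: "r *\<^sub>R d \<in> integer_points"
      using integer_points_scaled_add[OF c c0(1), of "- (m div int g)"] by (simp add: r_def algebra_simps)
    have "r * d $ i = of_int m - of_int (m div int g) * real g"
      by (simp add: r_def left_diff_distrib m c0(2) mult.assoc)
    also have "\<dots> = of_int (m mod int g)" by (simp add: minus_mult_div_eq_mod[symmetric] mult.commute)
    finally have r_eq: "r * d $ i = real (nat (m mod int g))" using \<open>g > 0\<close> by simp
    have "nat (m mod int g) < g" using \<open>g > 0\<close> by (simp add: nat_less_iff)
    then have "\<not> attained (nat (m mod int g))" using g(2) by (meson not_less)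
    then have "nat (m mod int g) = 0" using r_int r_eq by (auto simp: attained_def)
    then have "r = 0" using r_eq i by simp
    then have "c *\<^sub>R d = of_int (m div int g) *\<^sub>R (c0 *\<^sub>R d)" by (simp add: r_def)
    then show "\<exists>m::int. c *\<^sub>R d = of_int m *\<^sub>R (c0 *\<^sub>R d)" by blast
  qed (use c0 in auto)
qed

text \<open>Number the integer points on the line by \<open>p + m w\<close>. Among \<open>k\<close> distinct numbers the largest exceeds the
  least by at least \<open>k - 1\<close>, so \<open>k\<close> consecutive points fit between the extreme ones. For \<open>k = 1\<close> the direction is arbitrary.\<close>

lemma progression_from_colinear:
  fixes S :: "(real ^ 'n) set"
  assumes S: "convex S" "contains_colinear_integer_points k S" and k: "0 < k"
  shows "\<exists>x v. (x, v) \<in> progressions \<and> x \<in> S \<and> x + real (k - 1) *\<^sub>R v \<in> S"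
proof -
  obtain P where P: "P \<subseteq> S" "P \<subseteq> integer_points" "finite P" "card P = k" "collinear P"
    using S(2) by (auto simp: contains_colinear_integer_points_def)
  then obtain p where p: "p \<in> P" using k by fastforce
  show ?thesis
  proof (cases "k = 1")
    case True
    define e :: "real ^ 'n" where "e = (\<chi> i. 1)"
    have "e \<noteq> 0" by (simp add: e_def vec_eq_iff)
    then have "(p, e) \<in> progressions" using p P(2) by (auto simp: progressions_def integer_points_def e_def)
    then show ?thesis using p P(1) True by auto
  next
    case False
    then have "P \<noteq> {p}" using P(4) by auto
    then obtain q where q: "q \<in> P" "q \<noteq> p" using p by blast
    define d where "d = q - p"
    have d: "d \<in> integer_points" "d \<noteq> 0"
      using q p P(2) integer_points_diff[of q p] by (auto simp: d_def)
    obtain w where w: "w \<in> integer_points" "w \<noteq> 0"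
      "\<And>c. c *\<^sub>R d \<in> integer_points \<Longrightarrow> \<exists>m::int. c *\<^sub>R d = of_int m *\<^sub>R w"
      using integer_points_on_line_generated[OF d] by blast
    obtain u where u: "\<And>x y. x \<in> P \<Longrightarrow> y \<in> P \<Longrightarrow> \<exists>c. x - y = c *\<^sub>R u"
      using P(5) unfolding collinear_def by blast
    obtain c1 where c1: "d = c1 *\<^sub>R u" using u[OF q(1) p] by (auto simp: d_def)
    have "\<exists>m::int. y = p + of_int m *\<^sub>R w" if y: "y \<in> P" for y
    proof -
      obtain c2 where c2: "y - p = c2 *\<^sub>R u" using u[OF y p] by blast
      have "c1 \<noteq> 0" using c1 d by auto
      then have eq: "y - p = (c2 / c1) *\<^sub>R d" using c1 c2 by simp
      moreover have "y - p \<in> integer_points" using y p P(2) integer_points_diff[of y p] by auto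
      ultimately obtain m :: int where "y - p = of_int m *\<^sub>R w" using w(3)[of "c2 / c1"] by auto
      then have "y = p + of_int m *\<^sub>R w" by (simp add: algebra_simps)
      then show ?thesis by blast
    qed
    then obtain a :: "real ^ 'n \<Rightarrow> int" where a: "\<And>y. y \<in> P \<Longrightarrow> y = p + of_int (a y) *\<^sub>R w" by metis
    have "inj_on a P" using a by (metis inj_onI)
    then have card: "card (a ` P) = k" using P(4) by (simp add: card_image)
    have fin: "finite (a ` P)" "a ` P \<noteq> {}" using P(3) p by auto
    obtain y where y: "y \<in> P" "a y = Min (a ` P)" using Min_in[OF fin] by auto
    obtain z where z: "z \<in> P" "a z = Max (a ` P)" using Max_in[OF fin] by auto
    have "a ` P \<subseteq> {a y..a z}" using fin by (auto simp: y z)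
    then have "k \<le> card {a y..a z}" using card card_mono[of "{a y..a z}" "a ` P"] by simp
    then have le: "real (k - 1) \<le> of_int (a z - a y)" using k by simp
    have "z = y + of_int (n - m) *\<^sub>R w" if "y = p + of_int m *\<^sub>R w" "z = p + of_int n *\<^sub>R w" for m n
      using that by (simp add: algebra_simps)
    then have "z = y + of_int (a z - a y) *\<^sub>R w" using a[OF y(1)] a[OF z(1)] by blast
    then have "y + of_int (a z - a y) *\<^sub>R w \<in> S" using z(1) P(1) by auto
    moreover have yS: "y \<in> S" using y(1) P(1) by blast
    ultimately have "y + real (k - 1) *\<^sub>R w \<in> S"
      using convex_contains_translate[OF S(1) _ _ _ le, of y w] by simp
    moreover have "(y, w) \<in> progressions" using y(1) P(2) w by (auto simp: progressions_def)
    ultimately show ?thesis using yS by (intro exI[of _ y] exI[of _ w]) simp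
  qed
qed

section \<open>Fractional Helly theorem for colinear integer points\<close>

definition progression_set :: "nat \<Rightarrow> (real ^ 'n) set \<Rightarrow> ((real ^ 'n) \<times> (real ^ 'n)) set" where
  "progression_set k C = {(x, v). x \<in> C \<and> x + real (k - 1) *\<^sub>R v \<in> C}"

lemma convex_progression_set:
  assumes "convex C"
  shows "convex (progression_set k C)"
proof (rule convexI)
  fix p q :: "(real ^ 'a) \<times> (real ^ 'a)" and s t :: real
  assume p: "p \<in> progression_set k C" and q: "q \<in> progression_set k C" and st: "0 \<le> s" "0 \<le> t" "s + t = 1"
  have "s *\<^sub>R fst p + t *\<^sub>R fst q \<in> C"
    using p q st assms by (auto simp: progression_set_def intro: convexD)
  moreover have "s *\<^sub>R (fst p + real (k - 1) *\<^sub>R snd p) + t *\<^sub>R (fst q + real (k - 1) *\<^sub>R snd q) \<in> C"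
    by (rule convexD[OF assms]) (use p q st in \<open>auto simp: progression_set_def\<close>)
  ultimately show "s *\<^sub>R p + t *\<^sub>R q \<in> progression_set k C"
    by (simp add: progression_set_def case_prod_beta algebra_simps)
qed

theorem corollary1p8:
  fixes \<alpha> :: real
  assumes "0 < \<alpha>" and "\<alpha> \<le> 1"
  shows "\<exists>\<beta>>0. \<forall>(F :: (real ^ 'n) set set) (k :: nat).
    finite F \<longrightarrow> (\<forall>C\<in>F. convex C) \<longrightarrow> 0 < k \<longrightarrow>
    2 * CARD('n) + 1 \<le> card F \<longrightarrow>
    real (card {H. H \<subseteq> F \<and> card H = 2 * CARD('n) + 1 \<and>
                   contains_colinear_integer_points k (\<Inter>H)})
      \<ge> \<alpha> * real (card F choose (2 * CARD('n) + 1)) \<longrightarrow>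
    (\<exists>G. G \<subseteq> F \<and> real (card G) \<ge> \<beta> * real (card F) \<and>
         contains_colinear_integer_points k (\<Inter>G))"
proof -
  define q where "q = 2 * CARD('n) + 1"
  define h where "h = card (residue_pairs :: (('n \<Rightarrow> int) \<times> ('n \<Rightarrow> int)) set)"
  have dim: "Suc DIM((real ^ 'n) \<times> (real ^ 'n)) = q" by (simp add: q_def)
  have "(residue_pairs :: (('n \<Rightarrow> int) \<times> ('n \<Rightarrow> int)) set) \<noteq> {}"
    by (auto simp: residue_pairs_def PiE_eq_empty_iff)
  then have "0 < h" by (simp add: h_def card_gt_0_iff finite_residue_pairs)
  \<comment> \<open>a fraction \<open>\<alpha>\<close> of the \<open>q\<close>-element subsets is at least this fraction of the \<open>q\<close>-tuples, as \<open>(n / q) ^ q \<le> n choose q\<close>\<close>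
  have "0 < \<alpha> / real q ^ q" using assms by (simp add: q_def)
  from fractional_helly_finite_ground_set[OF this \<open>0 < h\<close>,
      where 'a = "(real ^ 'n) \<times> (real ^ 'n)" and 'i = "(real ^ 'n) set", unfolded dim]
  obtain \<beta> where \<beta>: "\<beta> > 0" and helly: "\<And>(T :: ((real ^ 'n) \<times> (real ^ 'n)) set) C V.
    finite T \<Longrightarrow> segment_rich h T \<Longrightarrow> finite V \<Longrightarrow> V \<noteq> {} \<Longrightarrow> \<forall>i\<in>V. convex (C i) \<Longrightarrow>
    \<alpha> / real q ^ q * real (card V ^ q) \<le>
      card {ys \<in> tuples V q. \<exists>x\<in>T. \<forall>i\<in>set ys. x \<in> C i} \<Longrightarrow>
    \<exists>p\<in>T. \<beta> * real (card V) \<le> card {i :: (real ^ 'n) set\<in>V. p \<in> C i}" by blast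
  have "\<exists>G. G \<subseteq> F \<and> real (card G) \<ge> \<beta> * real (card F) \<and> contains_colinear_integer_points k (\<Inter>G)"
    if F: "finite F" "\<forall>C\<in>F. convex C" and k: "0 < k" and card_F: "q \<le> card F"
      and dense: "\<alpha> * real (card F choose q) \<le>
        real (card {H. H \<subseteq> F \<and> card H = q \<and> contains_colinear_integer_points k (\<Inter>H)})"
    for F :: "(real ^ 'n) set set" and k
  proof -
    define \<H> where "\<H> = {H. H \<subseteq> F \<and> card H = q \<and> contains_colinear_integer_points k (\<Inter>H)}"
    have fin_\<H>: "finite \<H>" using F(1) by (auto simp: \<H>_def)
    have conv_Inter: "convex (\<Inter>G)" if "G \<subseteq> F" for G using F(2) that by (intro convex_Inter) auto
    have "\<exists>p. p \<in> progressions \<and> (\<forall>C\<in>H. p \<in> progression_set k C)" if "H \<in> \<H>" for H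
      using progression_from_colinear[OF conv_Inter _ k, of H] that
      by (fastforce simp: \<H>_def progression_set_def)
    then obtain pt where pt: "\<And>H. H \<in> \<H> \<Longrightarrow> pt H \<in> progressions"
        "\<And>H C. H \<in> \<H> \<Longrightarrow> C \<in> H \<Longrightarrow> pt H \<in> progression_set k C" by metis
    define T where "T = progressions \<inter> convex hull (pt ` \<H>)"
    have "finite T" unfolding T_def
      by (rule finite_progressions_bounded) (use fin_\<H> in \<open>simp add: bounded_convex_hull finite_imp_bounded\<close>)
    moreover have "segment_rich h T" unfolding T_def h_def
      by (rule progressions_segment_rich) (rule convex_convex_hull)
    moreover have "F \<noteq> {}" using card_F by (auto simp: q_def)
    moreover have "\<forall>C\<in>F. convex (progression_set k C)" using F(2) convex_progression_set by blast
    moreover have "\<alpha> / real q ^ q * real (card F ^ q) \<le>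
      card {ys \<in> tuples F q. \<exists>x\<in>T. \<forall>C\<in>set ys. x \<in> progression_set k C}"
    proof -
      have "\<exists>ys. set ys = H \<and> distinct ys" if "H \<in> \<H>" for H
        using that F(1) finite_distinct_list finite_subset unfolding \<H>_def by blast
      then obtain enum where enum: "\<And>H. H \<in> \<H> \<Longrightarrow> set (enum H) = H \<and> distinct (enum H)" by metis
      have "inj_on enum \<H>" using enum by (metis inj_onI)
      moreover have "enum ` \<H> \<subseteq> {ys \<in> tuples F q. \<exists>x\<in>T. \<forall>C\<in>set ys. x \<in> progression_set k C}"
      proof
        fix ys assume "ys \<in> enum ` \<H>"
        then obtain H where H: "H \<in> \<H>" "ys = enum H" by blast
        then have "set ys = H" "length ys = q" using enum[of H] distinct_card[of ys] by (auto simp: \<H>_def)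
        moreover have "pt H \<in> T" using pt(1)[OF H(1)] H(1) by (simp add: T_def hull_inc)
        ultimately show "ys \<in> {ys \<in> tuples F q. \<exists>x\<in>T. \<forall>C\<in>set ys. x \<in> progression_set k C}"
          using H(1) pt(2)[OF H(1)] by (auto simp: in_tuples_iff \<H>_def)
      qed
      ultimately have "card \<H> \<le> card {ys \<in> tuples F q. \<exists>x\<in>T. \<forall>C\<in>set ys. x \<in> progression_set k C}"
        by (rule card_inj_on_le) (simp add: finite_tuples F(1))
      moreover have "\<alpha> / real q ^ q * real (card F ^ q) \<le> card \<H>"
      proof -
        have "\<alpha> / real q ^ q * real (card F ^ q) = \<alpha> * (real (card F) / real q) ^ q"
          by (simp add: power_divide)
        also have "\<dots> \<le> \<alpha> * real (card F choose q)"
          using binomial_ge_n_over_k_pow_k[OF card_F, where 'a = real] assms by (intro mult_left_mono) auto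
        finally show ?thesis using dense by (simp add: \<H>_def)
      qed
      ultimately show ?thesis by linarith
    qed
    ultimately obtain p where p: "p \<in> T" "\<beta> * real (card F) \<le> card {C\<in>F. p \<in> progression_set k C}"
      using helly[of T F "progression_set k"] F(1) by blast
    obtain x v where xv: "p = (x, v)" by fastforce
    define G where "G = {C\<in>F. p \<in> progression_set k C}"
    have "contains_colinear_integer_points k (\<Inter>G)"
    proof (rule colinear_from_progression)
      show "convex (\<Inter>G)" by (rule conv_Inter) (auto simp: G_def)
      show "(x, v) \<in> progressions" using p(1) xv by (simp add: T_def)
      show "x \<in> \<Inter>G" "x + real (k - 1) *\<^sub>R v \<in> \<Inter>G" by (auto simp: G_def xv progression_set_def)
    qed
    then show ?thesis using p(2) by (intro exI[of _ G]) (auto simp: G_def)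
  qed
  then show ?thesis using \<beta> unfolding q_def by blast
qed

end
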